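(* Let $k$ be an algebraically closed field, let $m,n \in \mathbb{N}$, let $\mathbf{f} = (f_1,\ldots,f_m) \in (k[t_1,\ldots,t_n])^m$, and let $h : k^m \to k$ be an arbitrary function. Assume that $\mathbf{f}$ induces a surjective mapping from $k^n$ to $k^m$ and that $h \circ \mathbf{f}$ is a polynomial function (from $k^n$ to $k$). Then: (1) If $k$ is of characteristic $0$, then $h$ is a polynomial function. (2) If $k$ is of characteristic $\chi > 0$, then there is $\nu \in \mathbb{N}_0$ such that the function $h^{\chi^\nu} : k^m \to k$, $(y_1,\ldots,y_m) \mapsto h(y_1,\ldots,y_m)^{\chi^\nu}$ is a polynomial function.
   Context: $\mathbb{N}$ denotes the positive integers and $\mathbb{N}_0 = \mathbb{N}\cup\{0\}$. $h \circ \mathbf{f} : k^n \to k$ is the function $\mathbf{a} \mapsto h(f_1(\mathbf{a}),\ldots,f_m(\mathbf{a}))$. A polynomial function is a function induced by a polynomial with all its coefficients in $k$. *)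

theory Defs
  imports
    "HOL-Analysis.Finite_Cartesian_Product"
    "HOL-Library.Poly_Mapping"
    "HOL-Computational_Algebra.Computational_Algebra"
begin

text \<open>
  Polynomials over \<open>'a\<close> in variables indexed by \<open>'v\<close>: an exponent vector \<open>'v \<Rightarrow>\<^sub>0 nat\<close>
  stands for a monomial, and a polynomial assigns a coefficient to each of finitely many
  monomials. The affine space \<open>k\<^sup>n\<close> is \<open>'a ^ 'n\<close> with \<open>n = CARD('n) \<ge> 1\<close>.
\<close>

type_synonym ('v, 'a) mpoly = "('v \<Rightarrow>\<^sub>0 nat) \<Rightarrow>\<^sub>0 'a"

definition mpoly_eval :: "('n::finite, 'a::comm_semiring_1) mpoly \<Rightarrow> 'a ^ 'n \<Rightarrow> 'a" where
  "mpoly_eval p a =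
     (\<Sum>\<mu> \<in> Poly_Mapping.keys p.
        Poly_Mapping.lookup p \<mu> * (\<Prod>i \<in> UNIV. (a $ i) ^ Poly_Mapping.lookup \<mu> i))"

definition mpoly_map :: "('n::finite, 'a::comm_semiring_1) mpoly ^ 'm \<Rightarrow> 'a ^ 'n \<Rightarrow> 'a ^ 'm" where
  "mpoly_map f a = (\<chi> j. mpoly_eval (f $ j) a)"

definition polynomial_fun :: "('a ^ 'n::finite \<Rightarrow> 'a::comm_semiring_1) \<Rightarrow> bool" where
  "polynomial_fun g \<longleftrightarrow> (\<exists>p :: ('n, 'a) mpoly. \<forall>a. g a = mpoly_eval p a)"

end

theory Submission
  imports Defs
begin

text \<open>
  Let \<open>A = k[f\<^sub>1, \<dots>, f\<^sub>m]\<close>, \<open>g = h \<circ> f\<close>. Since \<open>g\<close> is constant on the fibres of \<open>f\<close>, Chevalley's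
  extension theorem shows that \<open>g\<close> is algebraic over \<open>A\<close> and that its minimal polynomial, specialised
  at a generic point, has only one root. So it specialises to a multiple of \<open>(T - g)\<^sup>d\<close>; writing
  \<open>d = q e\<close> with \<open>e \<noteq> 0\<close> in \<open>k\<close> and \<open>q\<close> a power of the characteristic exponent, the coefficient of
  \<open>T\<^bsup>q(e - 1)\<^esup>\<close> exhibits \<open>G = g\<^sup>q\<close> as a fraction over \<open>A\<close>.

  It remains to see that \<open>G\<close> lies in \<open>A\<close>. If \<open>b G = a\<close> with \<open>a, b \<in> A\<close>, then by surjectivity of \<open>f\<close>
  every zero of \<open>b\<close>, as a polynomial in \<open>f\<^sub>1, \<dots>, f\<^sub>m\<close>, is a zero of \<open>a\<close>. Cancelling the greatest
  common divisor with respect to \<open>f\<^sub>i\<close> yields, for each \<open>i\<close>, a denominator of \<open>G\<close> not involving \<open>f\<^sub>i\<close>.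
  Comparing these denominators one variable at a time produces a constant one.
\<close>

subsection \<open>Subrings and polynomials over them\<close>

definition is_subring :: "'b::comm_ring_1 set \<Rightarrow> bool" where
  "is_subring A \<longleftrightarrow> 1 \<in> A \<and> (\<forall>x\<in>A. \<forall>y\<in>A. x - y \<in> A \<and> x * y \<in> A)"

lemma is_subringD:
  assumes "is_subring A"
  shows "1 \<in> A" and "0 \<in> A" and "x \<in> A \<Longrightarrow> - x \<in> A"
    and "x \<in> A \<Longrightarrow> y \<in> A \<Longrightarrow> x - y \<in> A"
    and "x \<in> A \<Longrightarrow> y \<in> A \<Longrightarrow> x + y \<in> A"
    and "x \<in> A \<Longrightarrow> y \<in> A \<Longrightarrow> x * y \<in> A"
proof -
  show 1: "1 \<in> A" and diff: "\<And>x y. x \<in> A \<Longrightarrow> y \<in> A \<Longrightarrow> x - y \<in> A"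
    and "x \<in> A \<Longrightarrow> y \<in> A \<Longrightarrow> x * y \<in> A"
    using assms by (auto simp: is_subring_def)
  show 0: "0 \<in> A" using diff[OF 1 1] by simp
  show minus: "- x \<in> A" if "x \<in> A" for x using diff[OF 0 that] by simp
  show "x + y \<in> A" if "x \<in> A" "y \<in> A" using diff[OF that(1) minus[OF that(2)]] by simp
qed

lemma is_subring_power: "is_subring A \<Longrightarrow> x \<in> A \<Longrightarrow> x ^ n \<in> A"
  by (induction n) (auto intro: is_subringD)

lemma is_subring_sum: "is_subring A \<Longrightarrow> (\<And>i. i \<in> I \<Longrightarrow> u i \<in> A) \<Longrightarrow> sum u I \<in> A"
  by (induction I rule: infinite_finite_induct) (auto intro: is_subringD)

lemma is_subring_of_nat: "is_subring A \<Longrightarrow> of_nat n \<in> A"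
  by (induction n) (auto intro: is_subringD)

definition polys_over :: "'b::comm_ring_1 set \<Rightarrow> 'b poly set" where
  "polys_over A = {p. \<forall>i. coeff p i \<in> A}"

lemma polys_overD: "p \<in> polys_over A \<Longrightarrow> coeff p i \<in> A"
  by (simp add: polys_over_def)

lemma polys_over_mono: "A \<subseteq> B \<Longrightarrow> polys_over A \<subseteq> polys_over B"
  by (auto simp: polys_over_def)

lemma polys_over_smult: "is_subring A \<Longrightarrow> c \<in> A \<Longrightarrow> p \<in> polys_over A \<Longrightarrow> smult c p \<in> polys_over A"
  by (auto simp: polys_over_def intro: is_subringD)

lemma polys_over_monom: "is_subring A \<Longrightarrow> c \<in> A \<Longrightarrow> monom c n \<in> polys_over A"
  by (auto simp: polys_over_def intro: is_subringD)

lemma polys_over_const: "is_subring A \<Longrightarrow> c \<in> A \<Longrightarrow> [:c:] \<in> polys_over A"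
  using polys_over_monom[of A c 0] by (simp add: monom_0)

lemma is_subring_polys_over: "is_subring A \<Longrightarrow> is_subring (polys_over A)"
  unfolding is_subring_def[of "polys_over A"]
  by (auto simp: polys_over_def coeff_mult intro!: is_subring_sum intro: is_subringD)

lemma poly_in_subring:
  assumes "is_subring A" "p \<in> polys_over A" "x \<in> A"
  shows "poly p x \<in> A"
  unfolding poly_altdef
  by (intro is_subring_sum is_subringD(6) is_subring_power polys_overD assms)

text \<open>The leading coefficient of \<open>q\<close> need not be a unit of \<open>A\<close>.
  Multiplying \<open>p\<close> by it before each reduction makes the leading terms cancel without
  fractions, and the exponent \<open>e\<close> counts these multiplications.\<close>

lemma pseudo_division:
  fixes A :: "'b::idom set"
  assumes A: "is_subring A" and q: "q \<in> polys_over A" "q \<noteq> 0" and p: "p \<in> polys_over A"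
  shows "\<exists>e s r. s \<in> polys_over A \<and> r \<in> polys_over A \<and>
           smult (lead_coeff q ^ e) p = q * s + r \<and> (r = 0 \<or> degree r < degree q)"
  using p
proof (induction "degree p" arbitrary: p rule: less_induct)
  case less
  note P = is_subringD[OF is_subring_polys_over[OF A]]
  define c where "c = lead_coeff q"
  have c: "c \<in> A" "c \<noteq> 0" using q by (auto simp: c_def polys_overD)
  show ?case
  proof (cases "p = 0 \<or> degree p < degree q")
    case True
    then show ?thesis using less.prems P(2)
      by (intro exI[of _ 0] exI[of _ 0] exI[of _ p]) auto
  next
    case False
    \<comment> \<open>\<open>M\<close> is chosen so that \<open>q * M\<close> and
      \<open>smult c p\<close> agree in degree and leading coefficient; their difference
      \<open>p'\<close> is therefore zero or of smaller degree.\<close>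
    define M where "M = monom (lead_coeff p) (degree p - degree q)"
    define p' where "p' = smult c p - q * M"
    have M: "M \<in> polys_over A" using less.prems A by (auto simp: M_def polys_overD intro: polys_over_monom)
    have p': "p' \<in> polys_over A"
      unfolding p'_def using M less.prems q c A by (auto intro!: P(4,6) polys_over_smult)
    have deg_qM: "degree (q * M) = degree p"
      using False q by (auto simp: M_def degree_mult_eq degree_monom_eq)
    have lc_qM: "lead_coeff (q * M) = c * lead_coeff p"
      by (simp only: lead_coeff_mult M_def c_def lead_coeff_monom)
    have le: "degree p' \<le> degree p"
      unfolding p'_def using degree_diff_le[of "smult c p" "degree p" "q * M"] deg_qM by simp
    have top: "coeff p' (degree p) = 0"
      using lc_qM deg_qM by (simp add: p'_def)
    show ?thesis
    proof (cases "p' = 0")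
      case True
      then have "smult (c ^ 1) p = q * M + 0" by (simp add: p'_def)
      then show ?thesis unfolding c_def using M P(2) by blast
    next
      case nz: False
      then have "degree p' < degree p"
        using le top by (metis le_neq_implies_less leading_coeff_0_iff)
      from less.hyps[OF this p'] obtain e s r where
        *: "s \<in> polys_over A" "r \<in> polys_over A" "smult (c ^ e) p' = q * s + r"
           "r = 0 \<or> degree r < degree q" unfolding c_def by blast
      have "smult (c ^ Suc e) p = q * (s + smult (c ^ e) M) + r"
        using *(3) by (simp add: p'_def smult_diff_right algebra_simps)
      moreover have "s + smult (c ^ e) M \<in> polys_over A"
        using * M A c by (auto intro!: P(5) polys_over_smult is_subring_power)
      ultimately show ?thesis using * unfolding c_def by blast
    qed
  qed
qed

text \<open>
  A nonzero element of least degree in the ideal generated by two polynomials is, up to scalars,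
  their greatest common divisor.
\<close>
lemma gcd_up_to_scalars:
  fixes A :: "'b::idom set"
  assumes A: "is_subring A" and \<alpha>: "\<alpha> \<in> polys_over A" and \<beta>: "\<beta> \<in> polys_over A" "\<beta> \<noteq> 0"
  obtains w u v l \<alpha>' \<beta>' where "w \<in> polys_over A" "w \<noteq> 0" "u \<in> polys_over A" "v \<in> polys_over A"
    "w = u * \<alpha> + v * \<beta>" "l \<in> A" "l \<noteq> 0" "\<alpha>' \<in> polys_over A" "\<beta>' \<in> polys_over A"
    "smult l \<alpha> = w * \<alpha>'" "smult l \<beta> = w * \<beta>'"
proof -
  note P = is_subringD[OF is_subring_polys_over[OF A]]
  define I where "I = {u * \<alpha> + v * \<beta> | u v. u \<in> polys_over A \<and> v \<in> polys_over A}"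
  have I_sub: "I \<subseteq> polys_over A" using \<alpha> \<beta> by (auto simp: I_def intro!: P)
  have \<alpha>I: "\<alpha> \<in> I"
  proof -
    have "\<alpha> = 1 * \<alpha> + 0 * \<beta>" by simp
    then show ?thesis unfolding I_def using P(1,2) by blast
  qed
  have \<beta>I: "\<beta> \<in> I"
  proof -
    have "\<beta> = 0 * \<alpha> + 1 * \<beta>" by simp
    then show ?thesis unfolding I_def using P(1,2) by blast
  qed
  obtain w where w: "w \<in> I" "w \<noteq> 0" and min: "\<And>r. r \<in> I \<Longrightarrow> r \<noteq> 0 \<Longrightarrow> degree w \<le> degree r"
    using ex_has_least_nat[of "\<lambda>r. r \<in> I \<and> r \<noteq> 0" \<beta> degree] \<beta>I \<beta> by auto
  then obtain u v where uv: "u \<in> polys_over A" "v \<in> polys_over A" "w = u * \<alpha> + v * \<beta>"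
    by (auto simp: I_def)
  have wP: "w \<in> polys_over A" using w I_sub by auto
  \<comment> \<open>The remainder of \<open>p\<close> modulo \<open>w\<close> lies again in
    \<open>I\<close>, so minimality of \<open>degree w\<close> leaves only the remainder 0.\<close>
  have div: "\<exists>e s. s \<in> polys_over A \<and> smult (lead_coeff w ^ e) p = w * s" if p: "p \<in> I" for p
  proof -
    obtain e s r where *: "s \<in> polys_over A" "r \<in> polys_over A"
      "smult (lead_coeff w ^ e) p = w * s + r" "r = 0 \<or> degree r < degree w"
      using pseudo_division[OF A wP w(2)] p I_sub by blast
    from p obtain u' v' where uv': "u' \<in> polys_over A" "v' \<in> polys_over A" "p = u' * \<alpha> + v' * \<beta>"
      by (auto simp: I_def)
    let ?k = "lead_coeff w ^ e"
    have k: "?k \<in> A" using wP A by (auto intro: is_subring_power polys_overD)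
    have "r = smult ?k p - w * s" using *(3) by simp
    also have "\<dots> = (smult ?k u' - u * s) * \<alpha> + (smult ?k v' - v * s) * \<beta>"
      by (simp add: uv(3) uv'(3) algebra_simps smult_add_right)
    finally have "r \<in> I" unfolding I_def
      using uv uv' * k A by (blast intro: P polys_over_smult)
    then have "r = 0" using min[of r] * by fastforce
    then show ?thesis using * by auto
  qed
  obtain e1 s1 where 1: "s1 \<in> polys_over A" "smult (lead_coeff w ^ e1) \<alpha> = w * s1"
    using div[OF \<alpha>I] by blast
  obtain e2 s2 where 2: "s2 \<in> polys_over A" "smult (lead_coeff w ^ e2) \<beta> = w * s2"
    using div[OF \<beta>I] by blast
  let ?c = "lead_coeff w"
  have cA: "?c ^ n \<in> A" for n using wP A by (auto intro: is_subring_power polys_overD)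
  show thesis
  proof (rule that[OF wP w(2) uv cA[of "e1 + e2"]])
    show "?c ^ (e1 + e2) \<noteq> 0" using w by simp
    show "smult (?c ^ e2) s1 \<in> polys_over A" "smult (?c ^ e1) s2 \<in> polys_over A"
      using 1 2 cA A by (auto intro: polys_over_smult)
    show "smult (?c ^ (e1 + e2)) \<alpha> = w * smult (?c ^ e2) s1"
      using arg_cong[OF 1(2), of "smult (?c ^ e2)"] by (simp add: power_add mult_ac)
    show "smult (?c ^ (e1 + e2)) \<beta> = w * smult (?c ^ e1) s2"
      using arg_cong[OF 2(2), of "smult (?c ^ e1)"] by (simp add: power_add mult_ac)
  qed
qed

section \<open>Generated subrings and the adjunction of one element\<close>

inductive_set ring_gen :: "'b::comm_ring_1 set \<Rightarrow> 'b set" for X where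
  base: "x \<in> X \<Longrightarrow> x \<in> ring_gen X"
| one: "1 \<in> ring_gen X"
| diff: "x \<in> ring_gen X \<Longrightarrow> y \<in> ring_gen X \<Longrightarrow> x - y \<in> ring_gen X"
| mult: "x \<in> ring_gen X \<Longrightarrow> y \<in> ring_gen X \<Longrightarrow> x * y \<in> ring_gen X"

lemma is_subring_ring_gen: "is_subring (ring_gen X)"
  by (auto simp: is_subring_def intro: ring_gen.intros)

lemma ring_gen_least:
  assumes "is_subring A" "X \<subseteq> A"
  shows "ring_gen X \<subseteq> A"
proof
  fix x assume "x \<in> ring_gen X"
  then show "x \<in> A" by induction (use assms in \<open>auto intro: is_subringD\<close>)
qed

lemma ring_gen_mono: "X \<subseteq> Y \<Longrightarrow> ring_gen X \<subseteq> ring_gen Y"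
  by (rule ring_gen_least[OF is_subring_ring_gen]) (auto intro: ring_gen.base)

definition adjoin :: "'b::comm_ring_1 set \<Rightarrow> 'b \<Rightarrow> 'b set" where
  "adjoin A a = (\<lambda>p. poly p a) ` polys_over A"

lemma adjoinI: "p \<in> polys_over A \<Longrightarrow> poly p a \<in> adjoin A a"
  by (auto simp: adjoin_def)

lemma is_subring_adjoin:
  assumes "is_subring A"
  shows "is_subring (adjoin A a)"
proof -
  note P = is_subringD[OF is_subring_polys_over[OF assms]]
  show ?thesis
    unfolding is_subring_def
  proof (intro conjI ballI)
    show "1 \<in> adjoin A a" using adjoinI[OF P(1), of a] by simp
    fix x y assume "x \<in> adjoin A a" "y \<in> adjoin A a"
    then obtain p q where "p \<in> polys_over A" "x = poly p a" "q \<in> polys_over A" "y = poly q a"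
      by (auto simp: adjoin_def)
    then show "x - y \<in> adjoin A a" "x * y \<in> adjoin A a"
      using adjoinI[OF P(4), of p q a] adjoinI[OF P(6), of p q a] by auto
  qed
qed

lemma subset_adjoin: "is_subring A \<Longrightarrow> A \<subseteq> adjoin A a"
  using adjoinI[OF polys_over_const, of A _ a] by auto

lemma self_in_adjoin: "is_subring A \<Longrightarrow> a \<in> adjoin A a"
  using adjoinI[OF polys_over_monom, of A 1 1 a] by (auto simp: poly_monom intro: is_subringD)

lemma adjoin_least: "is_subring B \<Longrightarrow> A \<subseteq> B \<Longrightarrow> a \<in> B \<Longrightarrow> adjoin A a \<subseteq> B"
  using polys_over_mono[of A B] by (auto simp: adjoin_def intro: poly_in_subring)

lemma ring_gen_insert: "ring_gen (insert a X) = adjoin (ring_gen X) a"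
proof
  note S = is_subring_ring_gen
  show "ring_gen (insert a X) \<subseteq> adjoin (ring_gen X) a"
    using subset_adjoin[OF S, of X a] self_in_adjoin[OF S, of a X]
    by (intro ring_gen_least is_subring_adjoin S) (auto intro: ring_gen.base)
  show "adjoin (ring_gen X) a \<subseteq> ring_gen (insert a X)"
    by (intro adjoin_least S ring_gen_mono ring_gen.base) auto
qed

subsection \<open>Extending homomorphisms into an algebraically closed field\<close>

definition ring_hom_on :: "'b::comm_ring_1 set \<Rightarrow> ('b \<Rightarrow> 'c::comm_ring_1) \<Rightarrow> bool" where
  "ring_hom_on A \<phi> \<longleftrightarrow> \<phi> 1 = 1 \<and> (\<forall>x\<in>A. \<forall>y\<in>A. \<phi> (x - y) = \<phi> x - \<phi> y \<and> \<phi> (x * y) = \<phi> x * \<phi> y)"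

lemma ring_hom_onD:
  assumes "ring_hom_on A \<phi>" "is_subring A"
  shows "\<phi> 1 = 1" and "\<phi> 0 = 0"
    and "x \<in> A \<Longrightarrow> y \<in> A \<Longrightarrow> \<phi> (x - y) = \<phi> x - \<phi> y"
    and "x \<in> A \<Longrightarrow> y \<in> A \<Longrightarrow> \<phi> (x + y) = \<phi> x + \<phi> y"
    and "x \<in> A \<Longrightarrow> y \<in> A \<Longrightarrow> \<phi> (x * y) = \<phi> x * \<phi> y"
proof -
  note A = is_subringD[OF assms(2)]
  show "\<phi> 1 = 1" and diff: "\<And>x y. x \<in> A \<Longrightarrow> y \<in> A \<Longrightarrow> \<phi> (x - y) = \<phi> x - \<phi> y"
    and "x \<in> A \<Longrightarrow> y \<in> A \<Longrightarrow> \<phi> (x * y) = \<phi> x * \<phi> y"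
    using assms(1) by (auto simp: ring_hom_on_def)
  show 0: "\<phi> 0 = 0" using diff[OF A(1) A(1)] by simp
  show "\<phi> (x + y) = \<phi> x + \<phi> y" if "x \<in> A" "y \<in> A"
    using diff[OF that(1) A(3)[OF that(2)]] diff[OF A(2) that(2)] 0 by simp
qed

lemma ring_hom_on_sum:
  assumes "ring_hom_on A \<phi>" "is_subring A" "\<And>i. i \<in> I \<Longrightarrow> u i \<in> A"
  shows "\<phi> (sum u I) = (\<Sum>i\<in>I. \<phi> (u i))"
  using assms(3)
  by (induction I rule: infinite_finite_induct)
     (auto simp: ring_hom_onD[OF assms(1,2)] is_subring_sum[OF assms(2)])

lemma ring_hom_on_power:
  assumes "ring_hom_on A \<phi>" "is_subring A" "x \<in> A"
  shows "\<phi> (x ^ n) = \<phi> x ^ n"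
  by (induction n) (use assms in \<open>auto simp: ring_hom_onD is_subring_power\<close>)

context
  fixes A :: "'b::comm_ring_1 set" and \<phi> :: "'b \<Rightarrow> 'c::comm_ring_1"
  assumes hom: "ring_hom_on A \<phi>" and A: "is_subring A"
begin

lemma coeff_map_poly_hom: "coeff (map_poly \<phi> p) i = \<phi> (coeff p i)"
  by (simp add: coeff_map_poly ring_hom_onD[OF hom A])

lemma map_poly_hom_diff:
  "p \<in> polys_over A \<Longrightarrow> q \<in> polys_over A \<Longrightarrow> map_poly \<phi> (p - q) = map_poly \<phi> p - map_poly \<phi> q"
  by (rule poly_eqI) (simp add: coeff_map_poly_hom ring_hom_onD[OF hom A] polys_overD)

lemma map_poly_hom_add:
  "p \<in> polys_over A \<Longrightarrow> q \<in> polys_over A \<Longrightarrow> map_poly \<phi> (p + q) = map_poly \<phi> p + map_poly \<phi> q"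
  by (rule poly_eqI) (simp add: coeff_map_poly_hom ring_hom_onD[OF hom A] polys_overD)

lemma map_poly_hom_smult:
  "c \<in> A \<Longrightarrow> p \<in> polys_over A \<Longrightarrow> map_poly \<phi> (smult c p) = smult (\<phi> c) (map_poly \<phi> p)"
  by (rule poly_eqI) (simp add: coeff_map_poly_hom ring_hom_onD[OF hom A] polys_overD)

lemma map_poly_hom_mult:
  "p \<in> polys_over A \<Longrightarrow> q \<in> polys_over A \<Longrightarrow> map_poly \<phi> (p * q) = map_poly \<phi> p * map_poly \<phi> q"
  by (rule poly_eqI)
     (simp add: coeff_map_poly_hom coeff_mult ring_hom_on_sum[OF hom A] ring_hom_onD[OF hom A]
        polys_overD is_subringD[OF A])

lemma poly_map_poly_hom:
  assumes "p \<in> polys_over A" "a \<in> A"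
  shows "poly (map_poly \<phi> p) (\<phi> a) = \<phi> (poly p a)"
proof -
  have "poly (map_poly \<phi> p) (\<phi> a) = (\<Sum>i\<le>degree p. \<phi> (coeff p i) * \<phi> a ^ i)"
    unfolding poly_altdef coeff_map_poly_hom[symmetric]
    using map_poly_degree_leq[of \<phi> p]
    by (intro sum.mono_neutral_left) (auto simp: coeff_eq_0)
  also have "\<dots> = (\<Sum>i\<le>degree p. \<phi> (coeff p i * a ^ i))"
    using assms
    by (simp add: ring_hom_onD(5)[OF hom A] ring_hom_on_power[OF hom A] is_subring_power[OF A] polys_overD)
  also have "\<dots> = \<phi> (\<Sum>i\<le>degree p. coeff p i * a ^ i)"
    by (rule ring_hom_on_sum[OF hom A, symmetric])
       (intro is_subringD(6)[OF A] is_subring_power[OF A] polys_overD assms)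
  also have "\<dots> = \<phi> (poly p a)" by (simp add: poly_altdef)
  finally show ?thesis .
qed

text \<open>The assignment of \<open>poly (map_poly \<phi> p) z\<close> to \<open>poly p a\<close>
  is well defined as soon as \<open>z\<close> satisfies the image of every algebraic relation of
  \<open>a\<close> over \<open>A\<close>. It is then a homomorphism because
  \<open>map_poly \<phi>\<close> is one on \<open>polys_over A\<close>.\<close>

lemma extend_hom_adjoin:
  assumes "\<And>p. p \<in> polys_over A \<Longrightarrow> poly p a = 0 \<Longrightarrow> poly (map_poly \<phi> p) z = 0"
  obtains \<psi> where "ring_hom_on (adjoin A a) \<psi>" "\<And>x. x \<in> A \<Longrightarrow> \<psi> x = \<phi> x"
    "\<And>p. p \<in> polys_over A \<Longrightarrow> \<psi> (poly p a) = poly (map_poly \<phi> p) z"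
proof -
  note P = is_subringD[OF is_subring_polys_over[OF A]]
  \<comment> \<open>An arbitrary representation of \<open>u\<close> as a polynomial in
    \<open>a\<close> is chosen; two such representations differ by a relation of \<open>a\<close>,
    which \<open>z\<close> satisfies by assumption.\<close>
  define \<psi> where "\<psi> u = poly (map_poly \<phi> (SOME p. p \<in> polys_over A \<and> poly p a = u)) z" for u
  have \<psi>: "\<psi> (poly p a) = poly (map_poly \<phi> p) z" if p: "p \<in> polys_over A" for p
  proof -
    define q where "q = (SOME q. q \<in> polys_over A \<and> poly q a = poly p a)"
    have q: "q \<in> polys_over A \<and> poly q a = poly p a"
      unfolding q_def by (rule someI[of _ p]) (use p in auto)
    have "poly (map_poly \<phi> (q - p)) z = 0"
      by (rule assms) (use p q in \<open>auto intro: P\<close>)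
    then show ?thesis using p q by (simp add: \<psi>_def map_poly_hom_diff flip: q_def)
  qed
  show thesis
  proof (rule that[OF _ _ \<psi>])
    fix x assume "x \<in> A"
    then show "\<psi> x = \<phi> x"
      using \<psi>[of "[:x:]"] polys_over_const[OF A] by (simp add: map_poly_pCons ring_hom_onD[OF hom A])
  next
    show "ring_hom_on (adjoin A a) \<psi>"
      unfolding ring_hom_on_def
    proof (intro conjI ballI)
      show "\<psi> 1 = 1" using \<psi>[OF P(1)] by (simp add: ring_hom_onD[OF hom A])
      fix x y assume "x \<in> adjoin A a" "y \<in> adjoin A a"
      then obtain p q where *: "p \<in> polys_over A" "x = poly p a" "q \<in> polys_over A" "y = poly q a"
        by (auto simp: adjoin_def)
      show "\<psi> (x - y) = \<psi> x - \<psi> y"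
        using \<psi>[OF P(4)[OF *(1,3)]] * by (simp add: \<psi> map_poly_hom_diff)
      show "\<psi> (x * y) = \<psi> x * \<psi> y"
        using \<psi>[OF P(6)[OF *(1,3)]] * by (simp add: \<psi> map_poly_hom_mult)
    qed
  qed
qed

end

text \<open>The value \<open>z\<close> is kept explicit because two questions are asked of it: for
  Chevalley's theorem some \<open>z\<close> must be possible, whereas for \<open>g\<close> it has to
  be shown that only one \<open>z\<close> is possible.\<close>

definition extends_nonzero ::
  "'b::comm_ring_1 set \<Rightarrow> ('b \<Rightarrow> 'c::comm_ring_1) \<Rightarrow> 'b \<Rightarrow> 'c \<Rightarrow> 'b \<Rightarrow> bool" where
  "extends_nonzero A \<phi> a z b \<longleftrightarrow>
     (\<exists>\<psi>. ring_hom_on (adjoin A a) \<psi> \<and> (\<forall>x\<in>A. \<psi> x = \<phi> x) \<and> \<psi> a = z \<and> \<psi> b \<noteq> 0)"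

text \<open>Without relations every \<open>z\<close> is an admissible image of \<open>a\<close>.
  Writing \<open>b\<close> as \<open>poly \<beta> a\<close>, the only bad \<open>z\<close> are the
  roots of \<open>map_poly \<phi> \<beta>\<close>, and this polynomial is nonzero once
  \<open>\<phi>\<close> does not kill the leading coefficient of \<open>\<beta>\<close>, which
  serves as \<open>s\<close>.\<close>

lemma extend_hom_transcendental:
  fixes A :: "'b::idom set"
  assumes A: "is_subring A" and tr: "\<And>p. p \<in> polys_over A \<Longrightarrow> poly p a = 0 \<Longrightarrow> p = 0"
    and b: "b \<in> adjoin A a" "b \<noteq> 0"
  shows "\<exists>s\<in>A. s \<noteq> 0 \<and> (\<forall>\<phi> :: 'b \<Rightarrow> 'a::idom. ring_hom_on A \<phi> \<and> \<phi> s \<noteq> 0 \<longrightarrow>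
           (\<exists>r. r \<noteq> 0 \<and> (\<forall>z. poly r z \<noteq> 0 \<longrightarrow> extends_nonzero A \<phi> a z b)))"
proof -
  obtain \<beta> where \<beta>: "\<beta> \<in> polys_over A" "b = poly \<beta> a" using b by (auto simp: adjoin_def)
  show ?thesis
  proof (intro bexI[of _ "lead_coeff \<beta>"] conjI allI impI; (elim conjE)?)
    show "lead_coeff \<beta> \<in> A" "lead_coeff \<beta> \<noteq> 0" using \<beta> b by (auto simp: polys_overD)
    fix \<phi> :: "'b \<Rightarrow> 'a"
    assume hom: "ring_hom_on A \<phi>" and nz: "\<phi> (lead_coeff \<beta>) \<noteq> 0"
    have "map_poly \<phi> \<beta> \<noteq> 0" using nz coeff_map_poly_hom[OF hom A, of \<beta> "degree \<beta>"] by auto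
    moreover have "extends_nonzero A \<phi> a z b"
      if z: "poly (map_poly \<phi> \<beta>) z \<noteq> 0" for z
    proof -
      have "poly (map_poly \<phi> p) z = 0" if "p \<in> polys_over A" "poly p a = 0" for p
        using tr[OF that] by simp
      then obtain \<psi> where \<psi>: "ring_hom_on (adjoin A a) \<psi>" "\<And>x. x \<in> A \<Longrightarrow> \<psi> x = \<phi> x"
        "\<And>p. p \<in> polys_over A \<Longrightarrow> \<psi> (poly p a) = poly (map_poly \<phi> p) z"
        using extend_hom_adjoin[OF hom A] by metis
      have "\<psi> a = z"
        using \<psi>(3)[of "monom 1 1"] polys_over_monom[OF A is_subringD(1)[OF A]]
        by (simp add: poly_monom map_poly_monom ring_hom_onD[OF hom A])
      then show ?thesis
        unfolding extends_nonzero_def using \<psi> \<beta> z by (intro exI[of _ \<psi>]) auto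
    qed
    ultimately show "\<exists>r. r \<noteq> 0 \<and> (\<forall>z. poly r z \<noteq> 0 \<longrightarrow> extends_nonzero A \<phi> a z b)"
      by (intro exI[of _ "map_poly \<phi> \<beta>"]) auto
  qed
qed

text \<open>Up to powers of its leading coefficient, \<open>m\<close> divides every relation of
  \<open>a\<close>, so any root of \<open>map_poly \<phi> m\<close> is an admissible image. Since
  \<open>b\<close> is nonzero, \<open>\<beta>\<close> and \<open>m\<close> are coprime up to
  scalars, and a Bezout identity with constant \<open>w0\<close> prevents their images from having a
  common root. The element \<open>s\<close> is the leading coefficient of \<open>m\<close> times
  \<open>w0\<close>.\<close>

lemma extend_hom_algebraic:
  fixes A :: "'b::idom set"
  assumes A: "is_subring A"
    and m: "m \<in> polys_over A" "m \<noteq> 0" "poly m a = 0"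
    and min: "\<And>p. p \<in> polys_over A \<Longrightarrow> p \<noteq> 0 \<Longrightarrow> poly p a = 0 \<Longrightarrow> degree m \<le> degree p"
    and b: "b \<in> adjoin A a" "b \<noteq> 0"
  shows "\<exists>s\<in>A. s \<noteq> 0 \<and> (\<forall>\<phi> :: 'b \<Rightarrow> 'a::idom. ring_hom_on A \<phi> \<and> \<phi> s \<noteq> 0 \<longrightarrow>
           \<phi> (lead_coeff m) \<noteq> 0 \<and>
           (\<forall>z. poly (map_poly \<phi> m) z = 0 \<longrightarrow> extends_nonzero A \<phi> a z b))"
proof -
  obtain \<beta> where \<beta>: "\<beta> \<in> polys_over A" "b = poly \<beta> a" using b by (auto simp: adjoin_def)
  obtain w u v l \<beta>' m' where w: "w \<in> polys_over A" "w \<noteq> 0" "u \<in> polys_over A" "v \<in> polys_over A"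
    "w = u * \<beta> + v * m" "l \<in> A" "l \<noteq> 0" "\<beta>' \<in> polys_over A" "m' \<in> polys_over A"
    "smult l \<beta> = w * \<beta>'" "smult l m = w * m'"
    by (rule gcd_up_to_scalars[OF A \<beta>(1) m(1,2)])
  have "poly w a \<noteq> 0"
    using arg_cong[OF w(10), of "\<lambda>p. poly p a"] b \<beta> w(7) by auto
  \<comment> \<open>The common factor \<open>w\<close> does not vanish at \<open>a\<close>, so the
    cofactor \<open>m'\<close> of \<open>m\<close> does. Minimality of \<open>m\<close> then forces
    \<open>w\<close> to be constant.\<close>
  then have "poly m' a = 0"
    using arg_cong[OF w(11), of "\<lambda>p. poly p a"] m(3) by auto
  moreover have "m' \<noteq> 0" using w(7,11) m(2) by auto
  ultimately have "degree m \<le> degree m'" using min w(9) by blast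
  moreover have "degree m = degree w + degree m'"
    using arg_cong[OF w(11), of degree] w(2,7) \<open>m' \<noteq> 0\<close> by (simp add: degree_mult_eq)
  ultimately have "degree w = 0" by simp
  then obtain w0 where w0: "w = [:w0:]" by (elim degree_eq_zeroE)
  have w0A: "w0 \<in> A" "w0 \<noteq> 0" using w(1,2) polys_overD[of w A 0] by (auto simp: w0)
  let ?l = "lead_coeff m"
  have lA: "?l \<in> A" "?l \<noteq> 0" using m by (auto simp: polys_overD)
  have "\<phi> ?l \<noteq> 0 \<and> (\<forall>z. poly (map_poly \<phi> m) z = 0 \<longrightarrow> extends_nonzero A \<phi> a z b)"
    if hom: "ring_hom_on A \<phi>" and "\<phi> (?l * w0) \<noteq> 0" for \<phi> :: "'b \<Rightarrow> 'a"
  proof (intro conjI allI impI)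
    have nz: "\<phi> ?l \<noteq> 0" "\<phi> w0 \<noteq> 0"
      using that(2) lA w0A by (auto simp: ring_hom_onD[OF hom A])
    show "\<phi> ?l \<noteq> 0" by fact
    fix z assume z: "poly (map_poly \<phi> m) z = 0"
    \<comment> \<open>The remainder of a relation \<open>p\<close> modulo \<open>m\<close> is a
      relation of smaller degree, hence 0; the power of the leading coefficient in front of
      \<open>p\<close> can be cancelled because its image is nonzero.\<close>
    have "poly (map_poly \<phi> p) z = 0" if p: "p \<in> polys_over A" "poly p a = 0" for p
    proof -
      obtain e s r where *: "s \<in> polys_over A" "r \<in> polys_over A"
        "smult (?l ^ e) p = m * s + r" "r = 0 \<or> degree r < degree m"
        using pseudo_division[OF A m(1,2) p(1)] by blast
      have "poly r a = 0"
        using arg_cong[OF *(3), of "\<lambda>p. poly p a"] p(2) m(3) by simp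
      then have "r = 0" using *(4) min[OF *(2)] by (metis linorder_not_less)
      have "smult (\<phi> (?l ^ e)) (map_poly \<phi> p) = map_poly \<phi> (smult (?l ^ e) p)"
        by (rule map_poly_hom_smult[OF hom A is_subring_power[OF A lA(1)] p(1), symmetric])
      also have "\<dots> = map_poly \<phi> (m * s)"
        by (simp only: *(3) \<open>r = 0\<close> add_0_right)
      also have "\<dots> = map_poly \<phi> m * map_poly \<phi> s"
        by (rule map_poly_hom_mult[OF hom A m(1) *(1)])
      finally have "smult (\<phi> (?l ^ e)) (map_poly \<phi> p) = map_poly \<phi> m * map_poly \<phi> s" .
      from arg_cong[OF this, of "\<lambda>p. poly p z"] show ?thesis
        using nz lA z by (simp add: ring_hom_on_power[OF hom A])
    qed
    then obtain \<psi> where \<psi>: "ring_hom_on (adjoin A a) \<psi>" "\<And>x. x \<in> A \<Longrightarrow> \<psi> x = \<phi> x"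
      "\<And>p. p \<in> polys_over A \<Longrightarrow> \<psi> (poly p a) = poly (map_poly \<phi> p) z"
      using extend_hom_adjoin[OF hom A] by metis
    have \<psi>a: "\<psi> a = z"
      using \<psi>(3)[of "monom 1 1"] polys_over_monom[OF A is_subringD(1)[OF A]]
      by (simp add: poly_monom map_poly_monom ring_hom_onD[OF hom A])
    note PA = is_subringD[OF is_subring_polys_over[OF A]]
    have "[:\<phi> w0:] = map_poly \<phi> w"
      by (simp add: w0 map_poly_pCons ring_hom_onD[OF hom A])
    also have "\<dots> = map_poly \<phi> (u * \<beta>) + map_poly \<phi> (v * m)"
      unfolding w(5) by (intro map_poly_hom_add[OF hom A] PA(6) w \<beta> m)
    also have "\<dots> = map_poly \<phi> u * map_poly \<phi> \<beta> + map_poly \<phi> v * map_poly \<phi> m"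
      using map_poly_hom_mult[OF hom A w(3) \<beta>(1)] map_poly_hom_mult[OF hom A w(4) m(1)] by simp
    finally have "poly [:\<phi> w0:] z = poly (map_poly \<phi> u * map_poly \<phi> \<beta> + map_poly \<phi> v * map_poly \<phi> m) z"
      by (rule arg_cong)
    then have "poly (map_poly \<phi> u) z * poly (map_poly \<phi> \<beta>) z = \<phi> w0"
      using z by simp
    then have "\<psi> b \<noteq> 0" using nz \<psi>(3)[OF \<beta>(1)] \<beta>(2) by auto
    then show "extends_nonzero A \<phi> a z b"
      unfolding extends_nonzero_def using \<psi>(1,2) \<psi>a by blast
  qed
  moreover have "?l * w0 \<in> A" "?l * w0 \<noteq> 0" using lA w0A by (auto intro: is_subringD[OF A])
  ultimately show ?thesis by blast
qed

text \<open>Over a finite field the product of all \<open>[:- c, 1:]\<close> vanishes everywhere;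
  adding 1 gives a polynomial of positive degree without roots.\<close>

lemma infinite_UNIV_alg_closed: "infinite (UNIV :: 'a::alg_closed_field set)"
proof
  assume fin: "finite (UNIV :: 'a set)"
  define p :: "'a poly" where "p = (\<Prod>c\<in>UNIV. [:- c, 1:])"
  have "poly (p + 1) z = 1" for z :: 'a
    using fin by (simp add: p_def poly_prod prod_zero_iff)
  moreover have "degree p = card (UNIV :: 'a set)"
    unfolding p_def by (subst degree_prod_eq_sum_degree) auto
  then have "degree (p + 1) > 0"
    using fin by (subst degree_add_eq_left) (auto simp: card_gt_0_iff)
  ultimately show False using alg_closed_imp_poly_has_root[of "p + 1"] by auto
qed

lemma poly_nonroot_exists:
  fixes r :: "'a::alg_closed_field poly"
  assumes "r \<noteq> 0" "finite Z"
  obtains z where "poly r z \<noteq> 0" "z \<notin> Z"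
proof -
  have "finite ({z. poly r z = 0} \<union> Z)" using assms poly_roots_finite by auto
  then obtain z where "z \<notin> {z. poly r z = 0} \<union> Z"
    using infinite_UNIV_alg_closed[where ?'a='a] by (metis ex_new_if_finite)
  then show thesis using that by auto
qed

text \<open>Chevalley's extension theorem; compare Atiyah--Macdonald, Proposition 5.23.\<close>
theorem chevalley_extension:
  fixes X Y :: "'b::idom set"
  assumes "finite Y" "b \<in> ring_gen (X \<union> Y)" "b \<noteq> 0"
  shows "\<exists>s\<in>ring_gen X. s \<noteq> 0 \<and>
    (\<forall>\<phi> :: 'b \<Rightarrow> 'a::alg_closed_field. ring_hom_on (ring_gen X) \<phi> \<and> \<phi> s \<noteq> 0 \<longrightarrow>
       (\<exists>\<psi>. ring_hom_on (ring_gen (X \<union> Y)) \<psi> \<and> (\<forall>x\<in>ring_gen X. \<psi> x = \<phi> x) \<and> \<psi> b \<noteq> 0))"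
  using assms
proof (induction Y arbitrary: b rule: finite_induct)
  case empty
  then show ?case by auto
next
  case (insert a Y)
  define A where "A = ring_gen (X \<union> Y)"
  have A: "is_subring A" unfolding A_def by (rule is_subring_ring_gen)
  have XA: "ring_gen X \<subseteq> A" unfolding A_def by (rule ring_gen_mono) auto
  have adj: "ring_gen (X \<union> insert a Y) = adjoin A a" by (simp add: A_def flip: ring_gen_insert)
  note b = insert.prems[unfolded adj]
  \<comment> \<open>The passage from \<open>A\<close> to \<open>adjoin A a\<close>: a transcendental
    \<open>a\<close> may go to any non-root of a nonzero polynomial, an algebraic one to a root of
    its specialised minimal polynomial. Both exist in an algebraically closed field.\<close>
  obtain s where s: "s \<in> A" "s \<noteq> 0" and
    ext: "\<And>\<phi> :: 'b \<Rightarrow> 'a. ring_hom_on A \<phi> \<Longrightarrow> \<phi> s \<noteq> 0 \<Longrightarrow> \<exists>z. extends_nonzero A \<phi> a z b"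
  proof (cases "\<forall>p\<in>polys_over A. poly p a = 0 \<longrightarrow> p = 0")
    case True
    then obtain s where s: "s \<in> A" "s \<noteq> 0" and
      ext: "\<And>\<phi> :: 'b \<Rightarrow> 'a. ring_hom_on A \<phi> \<Longrightarrow> \<phi> s \<noteq> 0 \<Longrightarrow>
        \<exists>r. r \<noteq> 0 \<and> (\<forall>z. poly r z \<noteq> 0 \<longrightarrow> extends_nonzero A \<phi> a z b)"
      using extend_hom_transcendental[where ?'a = 'a, OF A _ b] by blast
    show thesis
    proof (rule that[OF s])
      fix \<phi> :: "'b \<Rightarrow> 'a" assume "ring_hom_on A \<phi>" "\<phi> s \<noteq> 0"
      from ext[OF this] obtain r where r: "r \<noteq> 0" "\<forall>z. poly r z \<noteq> 0 \<longrightarrow> extends_nonzero A \<phi> a z b"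
        by blast
      obtain z where "poly r z \<noteq> 0" using poly_nonroot_exists[OF r(1), of "{}"] by auto
      with r(2) show "\<exists>z. extends_nonzero A \<phi> a z b" by blast
    qed
  next
    case False
    then obtain m where m: "m \<in> polys_over A" "m \<noteq> 0" "poly m a = 0"
      and min: "\<And>p. p \<in> polys_over A \<Longrightarrow> p \<noteq> 0 \<Longrightarrow> poly p a = 0 \<Longrightarrow> degree m \<le> degree p"
      using ex_has_least_nat[of "\<lambda>p. p \<in> polys_over A \<and> p \<noteq> 0 \<and> poly p a = 0" _ degree] by blast
    obtain s where s: "s \<in> A" "s \<noteq> 0" and
      ext: "\<And>\<phi> :: 'b \<Rightarrow> 'a. ring_hom_on A \<phi> \<Longrightarrow> \<phi> s \<noteq> 0 \<Longrightarrow> \<phi> (lead_coeff m) \<noteq> 0 \<and>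
        (\<forall>z. poly (map_poly \<phi> m) z = 0 \<longrightarrow> extends_nonzero A \<phi> a z b)"
      using extend_hom_algebraic[where ?'a = 'a, OF A m min b] by blast
    show thesis
    proof (rule that[OF s])
      fix \<phi> :: "'b \<Rightarrow> 'a" assume \<phi>: "ring_hom_on A \<phi>" "\<phi> s \<noteq> 0"
      have "degree m \<noteq> 0"
      proof
        assume "degree m = 0"
        then obtain c where "m = [:c:]" by (elim degree_eq_zeroE)
        then show False using m(2,3) by simp
      qed
      then have "degree (map_poly \<phi> m) > 0"
        using ext[OF \<phi>] coeff_map_poly_hom[OF \<phi>(1) A, of m "degree m"]
          le_degree[of "map_poly \<phi> m" "degree m"] by auto
      then obtain z where "poly (map_poly \<phi> m) z = 0" using alg_closed_imp_poly_has_root by blast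
      with ext[OF \<phi>] show "\<exists>z. extends_nonzero A \<phi> a z b" by blast
    qed
  qed
  \<comment> \<open>The induction hypothesis is applied with \<open>s\<close> in the role of
    \<open>b\<close>, so that the extension to \<open>A\<close> still satisfies the condition for
    the last step.\<close>
  obtain t where t: "t \<in> ring_gen X" "t \<noteq> 0" and
    ext': "\<And>\<phi> :: 'b \<Rightarrow> 'a. ring_hom_on (ring_gen X) \<phi> \<Longrightarrow> \<phi> t \<noteq> 0 \<Longrightarrow>
      \<exists>\<psi>. ring_hom_on A \<psi> \<and> (\<forall>x\<in>ring_gen X. \<psi> x = \<phi> x) \<and> \<psi> s \<noteq> 0"
    using insert.IH[of s] s unfolding A_def by blast
  have "\<exists>\<psi>. ring_hom_on (adjoin A a) \<psi> \<and> (\<forall>x\<in>ring_gen X. \<psi> x = \<phi> x) \<and> \<psi> b \<noteq> 0"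
    if \<phi>: "ring_hom_on (ring_gen X) \<phi>" "\<phi> t \<noteq> 0" for \<phi> :: "'b \<Rightarrow> 'a"
  proof -
    from ext'[OF \<phi>] obtain \<phi>' where "ring_hom_on A \<phi>'" "\<forall>x\<in>ring_gen X. \<phi>' x = \<phi> x" "\<phi>' s \<noteq> 0" by blast
    with ext[of \<phi>'] XA show ?thesis unfolding extends_nonzero_def by (metis subsetD)
  qed
  then show ?case using t unfolding adj by blast
qed

subsection \<open>Removing denominators\<close>

text \<open>
  Divide \<open>c G\<close> by \<open>c\<close> as polynomials in \<open>t\<close>, with remainder \<open>r\<close>: then \<open>c\<close> divides \<open>c' r\<close>, whose degree
  in \<open>t\<close> is less than that of \<open>c\<close>, because \<open>c'\<close> does not involve \<open>t\<close>. Hence \<open>r = 0\<close>.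
\<close>
lemma denominator_elim:
  fixes G :: "'b::idom"
  assumes D: "is_subring D" and E: "is_subring E" and DE: "D \<subseteq> E"
    and tr: "\<And>p. p \<in> polys_over E \<Longrightarrow> poly p t = 0 \<Longrightarrow> p = 0"
    and c: "c \<in> adjoin D t" "c \<noteq> 0" "c * G \<in> adjoin E t"
    and c': "c' \<in> E" "c' \<noteq> 0" "c' * G \<in> adjoin E t"
  shows "\<exists>l\<in>D. l \<noteq> 0 \<and> l * G \<in> adjoin E t"
proof -
  note P = is_subringD[OF is_subring_polys_over[OF E]]
  obtain C where CD: "C \<in> polys_over D" and c_eq: "c = poly C t" using c by (auto simp: adjoin_def)
  have C: "C \<in> polys_over E" "C \<noteq> 0" using CD polys_over_mono[OF DE] c c_eq by auto
  obtain p where p: "p \<in> polys_over E" "c * G = poly p t" using c by (auto simp: adjoin_def)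
  obtain p' where p': "p' \<in> polys_over E" "c' * G = poly p' t" using c' by (auto simp: adjoin_def)
  obtain e s r where *: "s \<in> polys_over E" "r \<in> polys_over E"
    "smult (lead_coeff C ^ e) p = C * s + r" "r = 0 \<or> degree r < degree C"
    using pseudo_division[OF E C p(1)] by blast
  define l where "l = lead_coeff C ^ e"
  have lD: "l \<in> D" "l \<noteq> 0" using CD C D by (auto simp: l_def intro: is_subring_power polys_overD)
  have eq: "l * (c * G) = c * poly s t + poly r t"
    using arg_cong[OF *(3), of "\<lambda>p. poly p t"] by (simp add: l_def p flip: c_eq)
  \<comment> \<open>Multiplying \<open>l * (c * G) = c * poly s t + poly r t\<close> by
    \<open>c'\<close> and substituting \<open>p'\<close> for \<open>c' * G\<close> shows that
    \<open>c' * poly r t\<close> is \<open>c\<close> times the value of \<open>y\<close> at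
    \<open>t\<close>. Transcendence of \<open>t\<close> lifts this to an identity of polynomials,
    where degrees can be compared.\<close>
  define y where "y = smult l p' - smult c' s"
  have y: "y \<in> polys_over E" unfolding y_def
    using E lD DE c' p' * by (auto intro!: P(4) polys_over_smult)
  have "poly (smult c' r - C * y) t = c' * poly r t - c * (l * (c' * G) - c' * poly s t)"
    by (simp add: y_def p' flip: c_eq)
  also have "\<dots> = c' * (c * poly s t + poly r t - l * (c * G))" by (simp add: algebra_simps)
  also have "\<dots> = 0" using eq by simp
  finally have "smult c' r - C * y = 0"
    by (intro tr) (use E c' * C y in \<open>auto intro!: P(4,6) polys_over_smult\<close>)
  then have r_eq: "smult c' r = C * y" by simp
  have "r = 0"
  proof (rule ccontr)
    assume "r \<noteq> 0"
    then have "y \<noteq> 0" using r_eq c' by auto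
    then have "degree r = degree C + degree y"
      using arg_cong[OF r_eq, of degree] c' C by (simp add: degree_mult_eq)
    then show False using *(4) \<open>r \<noteq> 0\<close> by simp
  qed
  then have "c * (l * G) = c * poly s t" using eq by (simp add: mult_ac)
  then have "l * G = poly s t" using c by simp
  then show ?thesis using lD adjoinI[OF *(1)] by metis
qed

text \<open>A denominator of least degree in \<open>t\<close> is coprime, up to scalars, to its
  numerator, giving a Bezout identity with constant \<open>w0\<close>. If that degree were positive,
  \<open>pts\<close> would supply a homomorphism killing the denominator but not
  \<open>w0\<close>.\<close>

lemma denominator_free_of_generator:
  fixes G :: "'b::idom"
  assumes C: "is_subring C"
    and tr: "\<And>p. p \<in> polys_over C \<Longrightarrow> poly p t = 0 \<Longrightarrow> p = 0"
    and b: "b \<in> adjoin C t" "b \<noteq> 0" "b * G \<in> adjoin C t"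
    and pts: "\<And>w \<beta>. w \<in> C \<Longrightarrow> w \<noteq> 0 \<Longrightarrow> \<beta> \<in> polys_over C \<Longrightarrow> degree \<beta> > 0 \<Longrightarrow>
      \<exists>\<epsilon> :: 'b \<Rightarrow> 'c::idom. ring_hom_on UNIV \<epsilon> \<and> \<epsilon> w \<noteq> 0 \<and> \<epsilon> (poly \<beta> t) = 0"
  shows "\<exists>c\<in>C. c \<noteq> 0 \<and> c * G \<in> adjoin C t"
proof -
  define Q where "Q \<beta> \<longleftrightarrow> \<beta> \<in> polys_over C \<and> \<beta> \<noteq> 0 \<and> poly \<beta> t * G \<in> adjoin C t" for \<beta>
  obtain \<beta>0 where "\<beta>0 \<in> polys_over C" "b = poly \<beta>0 t" using b by (auto simp: adjoin_def)
  then have "Q \<beta>0" using b by (auto simp: Q_def)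
  then obtain \<beta> where "Q \<beta>" and min: "\<And>\<beta>'. Q \<beta>' \<Longrightarrow> degree \<beta> \<le> degree \<beta>'"
    using ex_has_least_nat[of Q \<beta>0 degree] by blast
  then have \<beta>: "\<beta> \<in> polys_over C" "\<beta> \<noteq> 0" and \<beta>G: "poly \<beta> t * G \<in> adjoin C t" by (auto simp: Q_def)
  from \<beta>G obtain \<alpha> where \<alpha>: "\<alpha> \<in> polys_over C" "poly \<beta> t * G = poly \<alpha> t" by (auto simp: adjoin_def)
  obtain w u v l \<alpha>' \<beta>' where w: "w \<in> polys_over C" "w \<noteq> 0" "u \<in> polys_over C" "v \<in> polys_over C"
    "w = u * \<alpha> + v * \<beta>" "l \<in> C" "l \<noteq> 0" "\<alpha>' \<in> polys_over C" "\<beta>' \<in> polys_over C"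
    "smult l \<alpha> = w * \<alpha>'" "smult l \<beta> = w * \<beta>'"
    by (rule gcd_up_to_scalars[OF C \<alpha>(1) \<beta>])
  \<comment> \<open>Cancelling \<open>w\<close> from numerator and denominator yields the
    denominator \<open>\<beta>'\<close>; by minimality of \<open>\<beta>\<close> it has no smaller
    degree, so \<open>w\<close> is constant.\<close>
  have wt: "poly w t \<noteq> 0" using tr w(1,2) by blast
  have "poly w t * (poly \<beta>' t * G) = l * (poly \<beta> t * G)"
    using arg_cong[OF w(11), of "\<lambda>p. poly p t"] by simp
  also have "\<dots> = poly w t * poly \<alpha>' t"
    using arg_cong[OF w(10), of "\<lambda>p. poly p t"] \<alpha>(2) by simp
  finally have "poly \<beta>' t * G = poly \<alpha>' t" using wt by simp
  moreover have "\<beta>' \<noteq> 0" using w(7,11) \<beta> by auto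
  ultimately have "degree \<beta> \<le> degree \<beta>'"
    using min[of \<beta>'] w(8,9) adjoinI[of \<alpha>' C t] by (simp add: Q_def)
  moreover have "degree \<beta> = degree w + degree \<beta>'"
    using arg_cong[OF w(11), of degree] w(2,7) \<open>\<beta>' \<noteq> 0\<close> by (simp add: degree_mult_eq)
  ultimately have "degree w = 0" by simp
  then obtain w0 where w0: "w = [:w0:]" by (elim degree_eq_zeroE)
  have w0C: "w0 \<in> C" "w0 \<noteq> 0" using w(1,2) polys_overD[of w C 0] by (auto simp: w0)
  have "degree \<beta> = 0"
  proof (rule ccontr)
    assume "degree \<beta> \<noteq> 0"
    then obtain \<epsilon> :: "'b \<Rightarrow> 'c" where \<epsilon>: "ring_hom_on UNIV \<epsilon>" "\<epsilon> w0 \<noteq> 0" "\<epsilon> (poly \<beta> t) = 0"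
      using pts[OF w0C \<beta>(1)] by auto
    have "is_subring (UNIV :: 'b set)" by (simp add: is_subring_def)
    note e = ring_hom_onD[OF \<epsilon>(1) this, simplified]
    \<comment> \<open>Since \<open>\<epsilon>\<close> is defined on the whole ring, it also has a
      value at \<open>G\<close>; hence the numerator, a multiple of the denominator there, is killed
      as well.\<close>
    have "\<epsilon> (poly \<alpha> t) = 0" using \<alpha>(2)[symmetric] \<epsilon>(3) by (simp add: e)
    moreover have "w0 = poly u t * poly \<alpha> t + poly v t * poly \<beta> t"
      using arg_cong[OF w(5), of "\<lambda>p. poly p t"] by (simp add: w0)
    ultimately show False using \<epsilon> by (simp add: e)
  qed
  then obtain c where "\<beta> = [:c:]" by (elim degree_eq_zeroE)
  then show ?thesis using \<beta> polys_overD[OF \<beta>(1), of 0] \<beta>G by auto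
qed

subsection \<open>The ring of polynomial functions\<close>

definition monomial_fun :: "'a \<Rightarrow> ('n::finite \<Rightarrow>\<^sub>0 nat) \<Rightarrow> 'a ^ 'n \<Rightarrow> 'a::comm_semiring_1" where
  "monomial_fun c \<mu> a = c * (\<Prod>i\<in>UNIV. (a $ i) ^ Poly_Mapping.lookup \<mu> i)"

lemma mpoly_eval_superset:
  assumes "finite S" "Poly_Mapping.keys p \<subseteq> S"
  shows "mpoly_eval p a = (\<Sum>\<mu>\<in>S. monomial_fun (Poly_Mapping.lookup p \<mu>) \<mu> a)"
  unfolding mpoly_eval_def monomial_fun_def
  using assms by (intro sum.mono_neutral_left) (auto simp: in_keys_iff)

lemma mpoly_eval_eq_sum:
  "mpoly_eval p a = (\<Sum>\<mu>\<in>Poly_Mapping.keys p. monomial_fun (Poly_Mapping.lookup p \<mu>) \<mu> a)"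
  by (rule mpoly_eval_superset) auto

lemma mpoly_eval_single: "mpoly_eval (Poly_Mapping.single \<mu> c) a = monomial_fun c \<mu> a"
  using mpoly_eval_superset[of "{\<mu>}" "Poly_Mapping.single \<mu> c" a] by (simp add: keys_single)

lemma mpoly_eval_add: "mpoly_eval (p + q) a = mpoly_eval p a + mpoly_eval q a"
proof -
  let ?S = "Poly_Mapping.keys p \<union> Poly_Mapping.keys q"
  have "mpoly_eval (p + q) a = (\<Sum>\<mu>\<in>?S. monomial_fun (Poly_Mapping.lookup (p + q) \<mu>) \<mu> a)"
    by (rule mpoly_eval_superset) (auto simp: in_keys_iff lookup_add)
  also have "\<dots> = mpoly_eval p a + mpoly_eval q a"
    by (simp add: mpoly_eval_superset[of ?S] lookup_add monomial_fun_def distrib_right sum.distrib)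
  finally show ?thesis .
qed

lemma polynomial_fun_monomial: "polynomial_fun (monomial_fun c \<mu>)"
  unfolding polynomial_fun_def by (metis mpoly_eval_single)

lemma polynomial_fun_add:
  "polynomial_fun u \<Longrightarrow> polynomial_fun v \<Longrightarrow> polynomial_fun (\<lambda>a. u a + v a)"
  unfolding polynomial_fun_def by (metis mpoly_eval_add)

lemma polynomial_fun_const: "polynomial_fun (\<lambda>a. c)"
  using polynomial_fun_monomial[of c 0] by (simp add: monomial_fun_def[abs_def])

lemma polynomial_fun_nth: "polynomial_fun (\<lambda>a. a $ i)"
proof -
  have "monomial_fun 1 (Poly_Mapping.single i 1) = (\<lambda>a :: 'a ^ 'b. a $ i)"
  proof
    fix a :: "'a ^ 'b"
    have "(\<Prod>j\<in>UNIV. (a $ j) ^ Poly_Mapping.lookup (Poly_Mapping.single i 1) j) =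
          (\<Prod>j\<in>UNIV. if j = i then a $ j else 1)"
      by (rule prod.cong) (auto simp: lookup_single)
    then show "monomial_fun 1 (Poly_Mapping.single i 1) a = a $ i" by (simp add: monomial_fun_def)
  qed
  then show ?thesis by (metis polynomial_fun_monomial)
qed

lemma polynomial_fun_sum:
  "(\<And>i. i \<in> I \<Longrightarrow> polynomial_fun (u i)) \<Longrightarrow> polynomial_fun (\<lambda>a. \<Sum>i\<in>I. u i a)"
  by (induction I rule: infinite_finite_induct) (auto intro: polynomial_fun_const polynomial_fun_add)

lemma polynomial_fun_mult:
  assumes "polynomial_fun u" "polynomial_fun v"
  shows "polynomial_fun (\<lambda>a. u a * v a)"
proof -
  obtain p q where *: "\<And>a. u a = mpoly_eval p a" "\<And>a. v a = mpoly_eval q a"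
    using assms unfolding polynomial_fun_def by blast
  have mono: "monomial_fun c \<mu> a * monomial_fun d \<nu> a = monomial_fun (c * d) (\<mu> + \<nu>) a" for c d \<mu> \<nu> a
    by (simp add: monomial_fun_def lookup_add power_add prod.distrib mult_ac)
  show ?thesis
    unfolding * mpoly_eval_eq_sum sum_product mono
    by (intro polynomial_fun_sum polynomial_fun_monomial)
qed

lemma polynomial_fun_diff:
  fixes u v :: "'a::comm_ring_1 ^ 'n::finite \<Rightarrow> 'a"
  assumes "polynomial_fun u" "polynomial_fun v"
  shows "polynomial_fun (\<lambda>a. u a - v a)"
  using polynomial_fun_add[OF assms(1) polynomial_fun_mult[OF polynomial_fun_const[of "-1"] assms(2)]]
  by simp

text \<open>Restriction to a line reduces the absence of zero divisors to polynomials in one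
  variable.\<close>

lemma polynomial_fun_on_line:
  fixes u :: "'a::comm_ring_1 ^ 'n::finite \<Rightarrow> 'a"
  assumes "polynomial_fun u"
  obtains p where "\<And>t. u (\<chi> i. a $ i + t * (b $ i - a $ i)) = poly p t"
proof -
  obtain q where q: "\<And>a. u a = mpoly_eval q a" using assms unfolding polynomial_fun_def by blast
  show thesis
    by (rule that[of "\<Sum>\<mu>\<in>Poly_Mapping.keys q. smult (Poly_Mapping.lookup q \<mu>)
              (\<Prod>i\<in>UNIV. [:a $ i, b $ i - a $ i:] ^ Poly_Mapping.lookup \<mu> i)"])
       (simp add: q mpoly_eval_def poly_sum poly_prod)
qed

text \<open>Functions are used instead of formal polynomials. Over the infinite field
  \<open>'a\<close> the two rings are isomorphic, and identities between functions can be checked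
  pointwise.\<close>

typedef (overloaded) ('a, 'n) polyfun =
  "{u :: 'a::alg_closed_field ^ 'n::finite \<Rightarrow> 'a. polynomial_fun u}"
  morphisms peval Abs_polyfun
  using polynomial_fun_const by blast

setup_lifting type_definition_polyfun

instantiation polyfun :: (alg_closed_field, finite) comm_ring_1
begin

lift_definition zero_polyfun :: "('a, 'b) polyfun" is "\<lambda>_. 0" by (rule polynomial_fun_const)
lift_definition one_polyfun :: "('a, 'b) polyfun" is "\<lambda>_. 1" by (rule polynomial_fun_const)
lift_definition plus_polyfun :: "('a, 'b) polyfun \<Rightarrow> ('a, 'b) polyfun \<Rightarrow> ('a, 'b) polyfun"
  is "\<lambda>u v a. u a + v a" by (rule polynomial_fun_add)
lift_definition minus_polyfun :: "('a, 'b) polyfun \<Rightarrow> ('a, 'b) polyfun \<Rightarrow> ('a, 'b) polyfun"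
  is "\<lambda>u v a. u a - v a" by (rule polynomial_fun_diff)
lift_definition uminus_polyfun :: "('a, 'b) polyfun \<Rightarrow> ('a, 'b) polyfun"
  is "\<lambda>u a. - u a" using polynomial_fun_diff[OF polynomial_fun_const[of 0]] by simp
lift_definition times_polyfun :: "('a, 'b) polyfun \<Rightarrow> ('a, 'b) polyfun \<Rightarrow> ('a, 'b) polyfun"
  is "\<lambda>u v a. u a * v a" by (rule polynomial_fun_mult)

instance
  by standard (transfer; simp add: algebra_simps fun_eq_iff)+

end

lift_definition pconst :: "'a::alg_closed_field \<Rightarrow> ('a, 'n::finite) polyfun" is "\<lambda>c _. c"
  by (rule polynomial_fun_const)

lift_definition pcoord :: "'n::finite \<Rightarrow> ('a::alg_closed_field, 'n) polyfun" is "\<lambda>i a. vec_nth a i"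
  by (rule polynomial_fun_nth)

lemma peval_simps [simp]:
  "peval 0 a = 0" "peval 1 a = 1" "peval (u + v) a = peval u a + peval v a"
  "peval (u - v) a = peval u a - peval v a" "peval (- u) a = - peval u a"
  "peval (u * v) a = peval u a * peval v a" "peval (pconst c) a = c" "peval (pcoord i) a = a $ i"
  by (transfer; simp)+

lemma peval_power [simp]: "peval (u ^ k) a = peval u a ^ k"
  by (induction k) auto

lemma peval_of_nat [simp]: "peval (of_nat k) a = of_nat k"
  by (induction k) auto

lemma peval_sum [simp]: "peval (sum u I) a = (\<Sum>i\<in>I. peval (u i) a)"
  by (induction I rule: infinite_finite_induct) auto

lemma peval_prod [simp]: "peval (prod u I) a = (\<Prod>i\<in>I. peval (u i) a)"
  by (induction I rule: infinite_finite_induct) auto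

lemma polyfun_eqI: "(\<And>a. peval u a = peval v a) \<Longrightarrow> u = v"
  by transfer auto

lemma polyfun_nonzeroE:
  assumes "u \<noteq> 0"
  obtains a where "peval u a \<noteq> 0"
  using assms polyfun_eqI[of u 0] by auto

text \<open>On the line joining a point where \<open>u\<close> is nonzero to one where
  \<open>v\<close> is nonzero, both restrict to nonzero polynomials in one variable, whose product
  is nonzero at some parameter.\<close>

instance polyfun :: (alg_closed_field, finite) idom
proof
  fix u v :: "('a, 'b) polyfun"
  assume "u \<noteq> 0" "v \<noteq> 0"
  then obtain a b where ab: "peval u a \<noteq> 0" "peval v b \<noteq> 0" by (metis polyfun_nonzeroE)
  define \<gamma> where "\<gamma> t = (\<chi> i. a $ i + t * (b $ i - a $ i))" for t
  have \<gamma>: "\<gamma> 0 = a" "\<gamma> 1 = b" by (simp_all add: \<gamma>_def vec_eq_iff)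
  obtain p where p: "\<And>t. peval u (\<gamma> t) = poly p t"
    using polynomial_fun_on_line[of "peval u" a b] peval unfolding \<gamma>_def by blast
  obtain q where q: "\<And>t. peval v (\<gamma> t) = poly q t"
    using polynomial_fun_on_line[of "peval v" a b] peval unfolding \<gamma>_def by blast
  have "p * q \<noteq> 0" using p[of 0] q[of 1] ab \<gamma> by auto
  then obtain t where "poly (p * q) t \<noteq> 0" using poly_nonroot_exists[of "p * q" "{}"] by auto
  then have "peval (u * v) (\<gamma> t) \<noteq> 0" by (simp add: p q)
  then show "u * v \<noteq> 0" by (metis peval_simps(1))
qed

lemma ring_hom_on_peval: "ring_hom_on A (\<lambda>u. peval u a)"
  by (simp add: ring_hom_on_def)

lemma polyfun_generated:
  "ring_gen (range pconst \<union> range pcoord) = (UNIV :: ('a::alg_closed_field, 'n::finite) polyfun set)"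
proof (intro equalityI subset_UNIV subsetI)
  fix u :: "('a, 'n) polyfun"
  let ?R = "ring_gen (range pconst \<union> range pcoord) :: ('a, 'n) polyfun set"
  have R: "is_subring ?R" by (rule is_subring_ring_gen)
  have prodR: "(\<And>i. i \<in> I \<Longrightarrow> w i \<in> ?R) \<Longrightarrow> prod w I \<in> ?R" for I :: "'n set" and w
    by (induction I rule: infinite_finite_induct) (auto intro: is_subringD[OF R])
  obtain q where q: "\<And>a. peval u a = mpoly_eval q a"
    using peval[of u] unfolding polynomial_fun_def by auto
  have "u = (\<Sum>\<mu>\<in>Poly_Mapping.keys q. pconst (Poly_Mapping.lookup q \<mu>) *
              (\<Prod>i\<in>UNIV. pcoord i ^ Poly_Mapping.lookup \<mu> i))"
    by (rule polyfun_eqI) (simp add: q mpoly_eval_def)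
  also have "\<dots> \<in> ?R"
    by (intro is_subring_sum[OF R] is_subringD(6)[OF R] prodR is_subring_power[OF R] ring_gen.base) auto
  finally show "u \<in> ?R" .
qed

text \<open>The images of the coordinate functions form the required point. This converts the
  abstract homomorphisms produced by Chevalley's theorem into points of affine space.\<close>

lemma polyfun_hom_eq_peval:
  fixes \<psi> :: "('a::alg_closed_field, 'n::finite) polyfun \<Rightarrow> 'a"
  assumes "ring_hom_on UNIV \<psi>" "\<And>c. \<psi> (pconst c) = c"
  obtains a where "\<And>u. \<psi> u = peval u a"
proof -
  define a where "a = (\<chi> i. \<psi> (pcoord i))"
  have "\<psi> u = peval u a" if "u \<in> ring_gen (range pconst \<union> range pcoord)" for u
    using that by induction (use assms in \<open>auto simp: ring_hom_on_def a_def\<close>)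
  then show thesis using that unfolding polyfun_generated by blast
qed

subsection \<open>Factoring through a surjective polynomial map\<close>

text \<open>In positive characteristic let \<open>q\<close> be the largest power of it dividing
  \<open>d\<close>, otherwise 1, and \<open>d = q * e\<close>. The Frobenius identity turns the
  power of \<open>T + c\<close> into the \<open>e\<close>-th power of \<open>T^q + c^q\<close>,
  whose second highest term in \<open>T^q\<close> has coefficient \<open>e * c^q\<close>.\<close>

lemma linear_power_coeff:
  assumes "d > 0"
  obtains q e :: nat where "of_nat e \<noteq> (0 :: 'a::field)"
    "CHAR('a) = 0 \<longrightarrow> q = 1" "CHAR('a) > 0 \<longrightarrow> (\<exists>\<nu>. q = CHAR('a) ^ \<nu>)"
    "\<And>c :: 'a. coeff ([:c, 1:] ^ d) (q * (e - 1)) = of_nat e * c ^ q"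
proof -
  obtain q e :: nat where qe: "d = q * e" "of_nat e \<noteq> (0 :: 'a)"
    "CHAR('a) = 0 \<longrightarrow> q = 1" "CHAR('a) > 0 \<longrightarrow> (\<exists>\<nu>. q = CHAR('a) ^ \<nu>)"
    and frob: "\<And>c :: 'a. [:c, 1:] ^ q = monom 1 q + [:c ^ q:]"
  proof (cases "CHAR('a) = 0")
    case True
    have "[:c, 1:] ^ 1 = monom 1 1 + [:c ^ 1:]" for c :: 'a by (simp add: monom_altdef)
    then show thesis using that[of 1 d] True assms by (simp add: of_nat_eq_0_iff_char_dvd)
  next
    case False
    then have prime: "prime CHAR('a)" using prime_CHAR_semidom by blast
    then have "\<not> is_unit CHAR('a)" by auto
    then obtain e where e: "d = CHAR('a) ^ multiplicity CHAR('a) d * e" "\<not> CHAR('a) dvd e"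
      using multiplicity_decompose'[of d "CHAR('a)"] assms by auto
    define q where "q = CHAR('a) ^ multiplicity CHAR('a) d"
    have "[:c, 1:] ^ q = monom 1 q + [:c ^ q:]" for c :: 'a
    proof -
      have "[:c, 1:] = monom 1 1 + [:c:]" by (simp add: monom_altdef)
      also have "\<dots> ^ q = monom 1 1 ^ q + [:c:] ^ q"
        by (rule freshmans_dream'[of _ "multiplicity CHAR('a) d"]) (use prime in \<open>simp_all add: q_def\<close>)
      also have "\<dots> = monom 1 q + [:c ^ q:]"
        by (simp add: monom_power poly_const_pow)
      finally show ?thesis .
    qed
    then show thesis using that[of q e] e False by (auto simp: q_def of_nat_eq_0_iff_char_dvd)
  qed
  have pos: "q > 0" "e > 0" using qe(1) assms by auto
  have "coeff ([:c, 1:] ^ d) (q * (e - 1)) = of_nat e * c ^ q" for c :: 'a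
  proof -
    have "[:c, 1:] ^ d = (monom 1 q + [:c ^ q:]) ^ e" by (simp add: qe(1) power_mult frob)
    also have "\<dots> = (\<Sum>k\<le>e. of_nat (e choose k) * monom 1 q ^ k * [:c ^ q:] ^ (e - k))"
      by (rule binomial_ring)
    also have "\<dots> = (\<Sum>k\<le>e. monom (of_nat (e choose k) * (c ^ q) ^ (e - k)) (q * k))"
      by (intro sum.cong refl)
         (simp add: monom_power poly_const_pow of_nat_poly smult_monom mult.commute)
    finally have "coeff ([:c, 1:] ^ d) (q * (e - 1)) =
        (\<Sum>k\<le>e. if q * k = q * (e - 1) then of_nat (e choose k) * (c ^ q) ^ (e - k) else 0)"
      by (simp add: coeff_sum)
    also have "\<dots> = (\<Sum>k\<le>e. if k = e - 1 then of_nat (e choose k) * (c ^ q) ^ (e - k) else 0)"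
      using pos by (intro sum.cong) auto
    also have "\<dots> = of_nat (e choose (e - 1)) * (c ^ q) ^ (e - (e - 1))"
      by (subst sum.delta) auto
    also have "\<dots> = of_nat e * c ^ q"
      using pos binomial_symmetric[of 1 e] by simp
    finally show ?thesis .
  qed
  then show thesis using that[of e q] qe by blast
qed

lemma poly_unique_root:
  fixes p :: "'a::alg_closed_field poly"
  assumes "\<And>z. poly p z = 0 \<Longrightarrow> z = c"
  shows "p = smult (lead_coeff p) ([:- c, 1:] ^ degree p)"
proof (cases "p = 0")
  case False
  then obtain Z where Z: "size Z = degree p" "p = smult (lead_coeff p) (\<Prod>x\<in>#Z. [:- x, 1:])"
    using alg_closed_imp_factorization by blast
  have "x = c" if "x \<in># Z" for x
  proof (rule assms)
    have "poly (\<Prod>x\<in>#Z. [:- x, 1:]) x = 0"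
      using that by (auto simp: poly_prod_mset prod_mset_zero_iff)
    then show "poly p x = 0" using arg_cong[OF Z(2), of "\<lambda>p. poly p x"] by simp
  qed
  then have "Z = replicate_mset (degree p) c"
    using Z(1) by (metis count_replicate_mset size_multiset_overloaded_eq set_mset_subset_singletonD
        singletonI subsetI)
  then show ?thesis using Z(2) by simp
qed auto

section \<open>The algebras generated by components of f\<close>

context
  fixes f :: "'m::finite \<Rightarrow> ('a::alg_closed_field, 'n::finite) polyfun"
begin

text \<open>This is the algebra k[f_j : j in T]. General \<open>T\<close> are needed because the f_j
  are removed from the denominator one at a time, the remaining ones acting as coefficients.\<close>

definition coeff_ring :: "'m set \<Rightarrow> ('a, 'n) polyfun set" where
  "coeff_ring T = ring_gen (range pconst \<union> f ` T)"

lemma is_subring_coeff_ring: "is_subring (coeff_ring T)"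
  by (simp add: coeff_ring_def is_subring_ring_gen)

lemma pconst_in_coeff_ring: "pconst c \<in> coeff_ring T"
  by (auto simp: coeff_ring_def intro: ring_gen.base)

lemma coeff_ring_mono: "S \<subseteq> T \<Longrightarrow> coeff_ring S \<subseteq> coeff_ring T"
  unfolding coeff_ring_def by (intro ring_gen_mono) auto

lemma coeff_ring_insert: "coeff_ring (insert i T) = adjoin (coeff_ring T) (f i)"
  by (simp add: coeff_ring_def flip: ring_gen_insert)

lemma coeff_ring_UNIV: "coeff_ring UNIV = adjoin (coeff_ring (- {i})) (f i)"
proof -
  have "insert i (- {i}) = UNIV" by auto
  then show ?thesis by (metis coeff_ring_insert)
qed

lemma coeff_ring_eqI:
  assumes "u \<in> coeff_ring T" "\<And>j. j \<in> T \<Longrightarrow> peval (f j) a = peval (f j) b"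
  shows "peval u a = peval u b"
  using assms(1) unfolding coeff_ring_def by induction (use assms(2) in auto)

text \<open>Translates membership in the algebra back into a polynomial function on the target
  space.\<close>

lemma coeff_ring_polynomial:
  assumes "u \<in> coeff_ring UNIV"
  shows "\<exists>p. polynomial_fun p \<and> (\<forall>a. peval u a = p (\<chi> j. peval (f j) a))"
  using assms unfolding coeff_ring_def
proof induction
  case (base x)
  then show ?case
  proof (elim UnE imageE; clarify)
    fix c show "\<exists>p. polynomial_fun p \<and> (\<forall>a. peval (pconst c) a = p (\<chi> j. peval (f j) a))"
      using polynomial_fun_const[of c] by (intro exI[of _ "\<lambda>_. c"]) auto
  next
    fix i show "\<exists>p. polynomial_fun p \<and> (\<forall>a. peval (f i) a = p (\<chi> j. peval (f j) a))"
      using polynomial_fun_nth[of i] by (intro exI[of _ "\<lambda>y. vec_nth y i"]) auto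
  qed
next
  case one
  then show ?case using polynomial_fun_const[of 1] by (intro exI[of _ "\<lambda>_. 1"]) auto
next
  case (diff x y)
  then obtain p q where "polynomial_fun p \<and> (\<forall>a. peval x a = p (\<chi> j. peval (f j) a))"
    "polynomial_fun q \<and> (\<forall>a. peval y a = q (\<chi> j. peval (f j) a))" by blast
  then show ?case by (intro exI[of _ "\<lambda>y. p y - q y"]) (auto intro: polynomial_fun_diff)
next
  case (mult x y)
  then obtain p q where "polynomial_fun p \<and> (\<forall>a. peval x a = p (\<chi> j. peval (f j) a))"
    "polynomial_fun q \<and> (\<forall>a. peval y a = q (\<chi> j. peval (f j) a))" by blast
  then show ?case by (intro exI[of _ "\<lambda>y. p y * q y"]) (auto intro: polynomial_fun_mult)
qed

lemma power_in_fraction_field: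
  assumes g: "\<And>a. peval g a = h (\<chi> j. peval (f j) a)"
  obtains q b where "CHAR('a) = 0 \<longrightarrow> q = 1" "CHAR('a) > 0 \<longrightarrow> (\<exists>\<nu>. q = CHAR('a) ^ \<nu>)"
    "b \<in> coeff_ring UNIV" "b \<noteq> 0" "b * g ^ q \<in> coeff_ring UNIV"
proof -
  define A where "A = coeff_ring UNIV"
  have A: "is_subring A" unfolding A_def by (rule is_subring_coeff_ring)
  have A1: "adjoin A g = ring_gen (insert g (range pconst \<union> range f))"
    by (simp add: A_def coeff_ring_def flip: ring_gen_insert)
  have gen: "ring_gen (insert g (range pconst \<union> range f) \<union> range pcoord) = UNIV"
    using ring_gen_mono[of "range pconst \<union> range pcoord" "insert g (range pconst \<union> range f) \<union> range pcoord"]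
      polyfun_generated by blast
  have fin: "finite (range (pcoord :: 'n \<Rightarrow> ('a, 'n) polyfun))" by simp
  have "(1 :: ('a, 'n) polyfun) \<in> ring_gen (insert g (range pconst \<union> range f) \<union> range pcoord)"
    by (rule ring_gen.one)
  \<comment> \<open>Chevalley's theorem for \<open>b = 1\<close>, adjoining the coordinates to
    \<open>adjoin A g\<close>: homomorphisms that do not kill \<open>s\<close> extend to the ring of
    all polynomial functions.\<close>
  from chevalley_extension[OF fin this, unfolded gen, folded A1]
  obtain s where s: "s \<in> adjoin A g" "s \<noteq> 0" and
    ext: "\<And>\<psi> :: ('a, 'n) polyfun \<Rightarrow> 'a. ring_hom_on (adjoin A g) \<psi> \<Longrightarrow> \<psi> s \<noteq> 0 \<Longrightarrow>
      \<exists>\<theta>. ring_hom_on UNIV \<theta> \<and> (\<forall>x\<in>adjoin A g. \<theta> x = \<psi> x)" by (metis zero_neq_one)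
  \<comment> \<open>The extended homomorphism is evaluation at some point \<open>b\<close>. It
    agrees with evaluation at \<open>a\<close> on all \<open>f j\<close>, so \<open>a\<close> and
    \<open>b\<close> lie in one fibre, on which \<open>g\<close> is constant.\<close>
  have determined: "z = peval g a"
    if "extends_nonzero A (\<lambda>x. peval x a) g z s" for a z
  proof -
    from that obtain \<psi> where \<psi>: "ring_hom_on (adjoin A g) \<psi>" "\<forall>x\<in>A. \<psi> x = peval x a" "\<psi> g = z" "\<psi> s \<noteq> 0"
      unfolding extends_nonzero_def by blast
    from ext[OF \<psi>(1,4)] obtain \<theta> where \<theta>: "ring_hom_on UNIV \<theta>" "\<forall>x\<in>adjoin A g. \<theta> x = \<psi> x" by blast
    have \<theta>A: "\<theta> x = peval x a" if "x \<in> A" for x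
      using \<theta>(2) \<psi>(2) subset_adjoin[OF A, of g] that by auto
    then have "\<theta> (pconst c) = c" for c using pconst_in_coeff_ring[of c UNIV] by (simp add: A_def)
    then obtain b where b: "\<And>u. \<theta> u = peval u b" using polyfun_hom_eq_peval[OF \<theta>(1)] by blast
    have "f j \<in> A" for j unfolding A_def coeff_ring_def by (auto intro: ring_gen.base)
    then have "peval (f j) b = peval (f j) a" for j using \<theta>A b by metis
    then have "peval g b = peval g a" by (simp add: g)
    moreover have "\<theta> g = z" using \<theta>(2) \<psi>(3) self_in_adjoin[OF A, of g] by auto
    ultimately show ?thesis using b by simp
  qed
  \<comment> \<open>If \<open>g\<close> were transcendental, all but finitely many \<open>z\<close>
    would be possible values of \<open>g\<close> over a suitable point, contrary to
    \<open>determined\<close>.\<close>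
  have "\<exists>m\<in>polys_over A. m \<noteq> 0 \<and> poly m g = 0"
  proof (rule ccontr)
    assume "\<not> ?thesis"
    then have tr: "\<And>p. p \<in> polys_over A \<Longrightarrow> poly p g = 0 \<Longrightarrow> p = 0" by blast
    obtain s' where s': "s' \<in> A" "s' \<noteq> 0" and
      ext': "\<And>\<phi> :: ('a, 'n) polyfun \<Rightarrow> 'a. ring_hom_on A \<phi> \<Longrightarrow> \<phi> s' \<noteq> 0 \<Longrightarrow>
        \<exists>r. r \<noteq> 0 \<and> (\<forall>z. poly r z \<noteq> 0 \<longrightarrow> extends_nonzero A \<phi> g z s)"
      using extend_hom_transcendental[where ?'a = 'a, OF A tr s] by blast
    obtain a where "peval s' a \<noteq> 0" using s' polyfun_nonzeroE by blast
    from ext'[OF ring_hom_on_peval this] obtain r where r: "r \<noteq> 0"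
      "\<forall>z. poly r z \<noteq> 0 \<longrightarrow> extends_nonzero A (\<lambda>x. peval x a) g z s" by blast
    obtain z where "poly r z \<noteq> 0" "z \<notin> {peval g a}"
      by (rule poly_nonroot_exists[OF r(1), of "{peval g a}"]) simp
    then show False using determined r(2) by auto
  qed
  then obtain m where m: "m \<in> polys_over A" "m \<noteq> 0" "poly m g = 0"
    and min: "\<And>p. p \<in> polys_over A \<Longrightarrow> p \<noteq> 0 \<Longrightarrow> poly p g = 0 \<Longrightarrow> degree m \<le> degree p"
    using ex_has_least_nat[of "\<lambda>p. p \<in> polys_over A \<and> p \<noteq> 0 \<and> poly p g = 0" _ degree] by blast
  have "degree m > 0"
  proof (rule ccontr)
    assume "\<not> degree m > 0"
    then obtain c where "m = [:c:]" by (auto elim: degree_eq_zeroE)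
    then show False using m(2,3) by simp
  qed
  from this obtain q e :: nat where qe: "of_nat e \<noteq> (0 :: 'a)"
    "CHAR('a) = 0 \<longrightarrow> q = 1" "CHAR('a) > 0 \<longrightarrow> (\<exists>\<nu>. q = CHAR('a) ^ \<nu>)"
    "\<And>c :: 'a. coeff ([:c, 1:] ^ degree m) (q * (e - 1)) = of_nat e * c ^ q"
    by (rule linear_power_coeff[where ?'a = 'a]) (rule that)
  define l where "l = lead_coeff m"
  define n where "n = coeff m (q * (e - 1))"
  obtain s' where s': "s' \<in> A" "s' \<noteq> 0" and
    ext': "\<And>\<phi> :: ('a, 'n) polyfun \<Rightarrow> 'a. ring_hom_on A \<phi> \<Longrightarrow> \<phi> s' \<noteq> 0 \<Longrightarrow>
      \<phi> (lead_coeff m) \<noteq> 0 \<and> (\<forall>z. poly (map_poly \<phi> m) z = 0 \<longrightarrow> extends_nonzero A \<phi> g z s)"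
    using extend_hom_algebraic[where ?'a = 'a, OF A m min s] by blast
  \<comment> \<open>Where \<open>s'\<close> is nonzero, the specialisation of \<open>m\<close> keeps
    its degree and has \<open>peval g a\<close> as its only root, so it is a multiple of a power of
    one linear factor, and one coefficient can be read off. The factor \<open>s'\<close> makes the
    identity valid at every point and is cancelled afterwards in the domain.\<close>
  have "peval (s' * (l * of_nat e * (- g) ^ q - n)) a = 0" for a
  proof (cases "peval s' a = 0")
    case False
    define M where "M = map_poly (\<lambda>u. peval u a) m"
    have coM: "coeff M i = peval (coeff m i) a" for i
      unfolding M_def by (rule coeff_map_poly_hom[OF ring_hom_on_peval A])
    have "peval l a \<noteq> 0" using ext'[OF ring_hom_on_peval False] by (simp add: l_def)
    then have degM: "degree M = degree m"
      using le_degree[of M "degree m"] map_poly_degree_leq[of "\<lambda>u. peval u a" m, folded M_def]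
      by (simp add: coM l_def)
    have root: "z = peval g a" if "poly M z = 0" for z
      using ext'[OF ring_hom_on_peval False] determined that by (simp add: M_def)
    have "M = smult (lead_coeff M) ([:- peval g a, 1:] ^ degree M)"
      by (rule poly_unique_root) (rule root)
    then have "coeff M (q * (e - 1)) =
        coeff (smult (lead_coeff M) ([:- peval g a, 1:] ^ degree M)) (q * (e - 1))"
      by (rule arg_cong)
    also have "\<dots> = peval l a * (of_nat e * (- peval g a) ^ q)"
      by (simp only: degM coeff_smult qe(4) coM l_def)
    finally have "coeff M (q * (e - 1)) = peval l a * (of_nat e * (- peval g a) ^ q)" .
    then show ?thesis by (simp add: coM n_def mult.assoc)
  qed simp
  then have "s' * (l * of_nat e * (- g) ^ q - n) = 0" by (intro polyfun_eqI) simp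
  then have eq: "l * of_nat e * (- g) ^ q = n" using s' by simp
  show thesis
  \<comment> \<open>The sign comes from the linear factor having constant term \<open>- g\<close>;
    the denominator is nonzero because \<open>e\<close> is nonzero in the field.\<close>
  proof (rule that[of q "l * of_nat e * (- 1) ^ q", folded A_def])
    have "of_nat e \<noteq> (0 :: ('a, 'n) polyfun)" using qe(1) by (metis peval_of_nat peval_simps(1))
    then show "l * of_nat e * (- 1) ^ q \<noteq> 0" using m(2) by (simp add: l_def)
    show "l * of_nat e * (- 1) ^ q \<in> A"
      using m(1) A by (auto simp: l_def intro!: is_subringD(6) is_subring_of_nat is_subring_power
          intro: polys_overD is_subringD)
    have "l * of_nat e * (- 1) ^ q * g ^ q = n"
      using eq by (simp add: power_minus[of g] mult.assoc)
    then show "l * of_nat e * (- 1) ^ q * g ^ q \<in> A" using m(1) by (simp add: n_def polys_overD)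
  qed (use qe in auto)
qed

section \<open>Consequences of surjectivity\<close>

context
  assumes surj: "\<And>y. \<exists>a. (\<chi> j. peval (f j) a) = y"
begin

text \<open>By surjectivity some point has the same image as \<open>a\<close> except for a
  prescribed \<open>i\<close>-th component. This lets \<open>f i\<close> be treated as a free
  variable over the other components.\<close>

lemma move_point:
  "\<exists>b. peval (f i) b = z \<and> (\<forall>u\<in>coeff_ring (- {i}). peval u b = peval u a)"
proof -
  from surj[of "\<chi> j. if j = i then z else peval (f j) a"]
  obtain b where "(\<chi> j. peval (f j) b) = (\<chi> j. if j = i then z else peval (f j) a)" ..
  then have b: "peval (f j) b = (if j = i then z else peval (f j) a)" for j
    by (simp add: vec_eq_iff)
  have "peval u b = peval u a" if "u \<in> coeff_ring (- {i})" for u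
    using that by (rule coeff_ring_eqI) (simp add: b)
  then show ?thesis by (intro exI[of _ b]) (simp add: b)
qed

text \<open>Specialise a nonzero \<open>p\<close> at a point where its leading coefficient survives,
  pick a non-root \<open>z\<close>, and move the point so that \<open>f i\<close> takes the value
  \<open>z\<close>: the coefficients stay the same and \<open>poly p (f i)\<close> is nonzero
  there.\<close>

lemma coordinate_transcendental:
  assumes p: "p \<in> polys_over (coeff_ring (- {i}))" "poly p (f i) = 0"
  shows "p = 0"
proof (rule ccontr)
  assume "p \<noteq> 0"
  then obtain a where a: "peval (lead_coeff p) a \<noteq> 0"
    using polyfun_nonzeroE[of "lead_coeff p"] by auto
  have coeff_at: "coeff (map_poly (\<lambda>u. peval u b) p) k = peval (coeff p k) b" for b k
    by (simp add: coeff_map_poly)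
  have "map_poly (\<lambda>u. peval u a) p \<noteq> 0" using a coeff_at[of a "degree p"] by auto
  then obtain z where z: "poly (map_poly (\<lambda>u. peval u a) p) z \<noteq> 0"
    by (rule poly_nonroot_exists[of _ "{}"]) auto
  obtain b where b: "peval (f i) b = z" "\<And>u. u \<in> coeff_ring (- {i}) \<Longrightarrow> peval u b = peval u a"
    using move_point[of i z a] by blast
  have "map_poly (\<lambda>u. peval u a) p = map_poly (\<lambda>u. peval u b) p"
    by (rule poly_eqI) (simp add: coeff_at b(2) polys_overD[OF p(1)])
  then have "poly (map_poly (\<lambda>u. peval u a) p) z = peval (poly p (f i)) b"
    using poly_map_poly_hom[OF ring_hom_on_peval, of UNIV p "f i" b] b(1)
    by (simp add: is_subring_def polys_over_def)
  then show False using z p(2) by simp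
qed

lemma denominator_free_of:
  assumes "b \<in> coeff_ring UNIV" "b \<noteq> 0" "b * G \<in> coeff_ring UNIV"
  shows "\<exists>c\<in>coeff_ring (- {i}). c \<noteq> 0 \<and> c * G \<in> coeff_ring UNIV"
proof -
  note adj = coeff_ring_UNIV[of i]
  have "\<exists>c\<in>coeff_ring (- {i}). c \<noteq> 0 \<and> c * G \<in> adjoin (coeff_ring (- {i})) (f i)"
  proof (rule denominator_free_of_generator[where ?'c = 'a, OF is_subring_coeff_ring])
    fix w and \<beta> :: "('a, 'n) polyfun poly"
    assume w: "w \<in> coeff_ring (- {i})" "w \<noteq> 0" and
      \<beta>: "\<beta> \<in> polys_over (coeff_ring (- {i}))" "degree \<beta> > 0"
    have "lead_coeff \<beta> \<noteq> 0" using \<beta>(2) by auto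
    \<comment> \<open>At such a point \<open>\<beta>\<close> specialises to a polynomial of positive
      degree, which has a root \<open>z\<close>. Moving \<open>f i\<close> to \<open>z\<close> kills
      \<open>poly \<beta> (f i)\<close> without changing the value of \<open>w\<close>, as
      \<open>w\<close> does not involve \<open>f i\<close>.\<close>
    then obtain a where "peval (w * lead_coeff \<beta>) a \<noteq> 0"
      using w(2) polyfun_nonzeroE[of "w * lead_coeff \<beta>"] by auto
    then have a: "peval w a \<noteq> 0" "peval (lead_coeff \<beta>) a \<noteq> 0" by auto
    define B where "B b = map_poly (\<lambda>u. peval u b) \<beta>" for b
    have coeff_at: "coeff (B b) k = peval (coeff \<beta> k) b" for b k
      by (simp add: B_def coeff_map_poly)
    have "degree (B a) > 0"
      using a(2) le_degree[of "B a" "degree \<beta>"] \<beta>(2) by (simp add: coeff_at)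
    then obtain z where z: "poly (B a) z = 0" using alg_closed_imp_poly_has_root by blast
    obtain b where b: "peval (f i) b = z" "\<And>u. u \<in> coeff_ring (- {i}) \<Longrightarrow> peval u b = peval u a"
      using move_point[of i z a] by blast
    have "B b = B a" by (rule poly_eqI) (simp add: coeff_at b(2) polys_overD[OF \<beta>(1)])
    then have "peval (poly \<beta> (f i)) b = 0"
      using poly_map_poly_hom[OF ring_hom_on_peval, of UNIV \<beta> "f i" b] b(1) z
      by (simp add: is_subring_def polys_over_def B_def)
    moreover have "peval w b \<noteq> 0" using a(1) b(2)[OF w(1)] by simp
    ultimately show "\<exists>\<epsilon> :: ('a, 'n) polyfun \<Rightarrow> 'a.
        ring_hom_on UNIV \<epsilon> \<and> \<epsilon> w \<noteq> 0 \<and> \<epsilon> (poly \<beta> (f i)) = 0"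
      by (intro exI[of _ "\<lambda>u. peval u b"]) (simp add: ring_hom_on_peval)
  qed (use assms coordinate_transcendental in \<open>auto simp flip: adj\<close>)
  then show ?thesis by (simp flip: adj)
qed

text \<open>Induction on the set \<open>T\<close> of components already absent from the denominator.
  To remove \<open>f i\<close> as well, \<open>denominator_elim\<close> compares the current
  denominator with one free of \<open>f i\<close> alone. At the end the denominator is a nonzero
  constant, hence invertible.\<close>

lemma fraction_in_coeff_ring:
  assumes b: "b \<in> coeff_ring UNIV" "b \<noteq> 0" "b * G \<in> coeff_ring UNIV"
  shows "G \<in> coeff_ring UNIV"
proof -
  have "\<exists>l\<in>coeff_ring (- T). l \<noteq> 0 \<and> l * G \<in> coeff_ring UNIV" if "finite T" for T
    using that
  proof (induction T)
    case empty
    then show ?case using b by auto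
  next
    case (insert i T)
    then obtain c where c: "c \<in> coeff_ring (- T)" "c \<noteq> 0" "c * G \<in> coeff_ring UNIV" by blast
    obtain c' where c': "c' \<in> coeff_ring (- {i})" "c' \<noteq> 0" "c' * G \<in> coeff_ring UNIV"
      using denominator_free_of[OF b] by blast
    note adj = coeff_ring_UNIV[of i]
    have "- T = insert i (- insert i T)" using insert.hyps by auto
    then have adjT: "coeff_ring (- T) = adjoin (coeff_ring (- insert i T)) (f i)"
      by (metis coeff_ring_insert)
    show ?case
      unfolding adj
      by (rule denominator_elim[OF is_subring_coeff_ring is_subring_coeff_ring _
            coordinate_transcendental c(1)[unfolded adjT] c(2) c(3)[unfolded adj]
            c'(1,2) c'(3)[unfolded adj]])
         (auto intro!: coeff_ring_mono)
  qed
  from this[of UNIV] obtain l where l: "l \<in> coeff_ring {}" "l \<noteq> 0" "l * G \<in> coeff_ring UNIV" by auto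
  have const: "\<exists>c. u = pconst c" if "u \<in> coeff_ring {}" for u
    using that unfolding coeff_ring_def
  proof induction
    case one
    show ?case by (intro exI[of _ 1] polyfun_eqI) simp
  next
    case (diff x y)
    then obtain c d where "x = pconst c" "y = pconst d" by blast
    then show ?case by (intro exI[of _ "c - d"] polyfun_eqI) simp
  next
    case (mult x y)
    then obtain c d where "x = pconst c" "y = pconst d" by blast
    then show ?case by (intro exI[of _ "c * d"] polyfun_eqI) simp
  qed auto
  then obtain c where "l = pconst c" using l(1) by blast
  moreover have "c \<noteq> 0" using l(2) calculation by (auto intro: polyfun_eqI)
  ultimately have "G = pconst (inverse c) * (l * G)" by (intro polyfun_eqI) simp
  moreover have "pconst (inverse c) * (l * G) \<in> coeff_ring UNIV"
    by (rule is_subringD(6)[OF is_subring_coeff_ring pconst_in_coeff_ring l(3)])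
  ultimately show ?thesis by metis
qed

lemma power_polynomial_fun:
  assumes g: "\<And>a. peval g a = h (\<chi> j. peval (f j) a)"
  obtains q where "CHAR('a) = 0 \<longrightarrow> q = 1" "CHAR('a) > 0 \<longrightarrow> (\<exists>\<nu>. q = CHAR('a) ^ \<nu>)"
    "polynomial_fun (\<lambda>y. h y ^ q)"
proof -
  obtain q b where q: "CHAR('a) = 0 \<longrightarrow> q = 1" "CHAR('a) > 0 \<longrightarrow> (\<exists>\<nu>. q = CHAR('a) ^ \<nu>)"
    and b: "b \<in> coeff_ring UNIV" "b \<noteq> 0" "b * g ^ q \<in> coeff_ring UNIV"
    by (rule power_in_fraction_field[OF g])
  obtain p where p: "polynomial_fun p" "\<And>a. peval (g ^ q) a = p (\<chi> j. peval (f j) a)"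
    using coeff_ring_polynomial[OF fraction_in_coeff_ring[OF b]] by blast
  \<comment> \<open>Surjectivity extends the identity from values of the map to every
    \<open>y\<close>.\<close>
  have "h y ^ q = p y" for y using surj[of y] p(2) by (auto simp: g)
  then show thesis using that[of q] q p(1) by presburger
qed

end

end

theorem corollary4p2:
  fixes f :: "('n::finite, 'a::alg_closed_field) mpoly ^ 'm::finite"
    and h :: "'a ^ 'm \<Rightarrow> 'a"
  assumes "surj (mpoly_map f)"
    and "polynomial_fun (h \<circ> mpoly_map f)"
  shows "(CHAR('a) = 0 \<longrightarrow> polynomial_fun h) \<and>
         (CHAR('a) > 0 \<longrightarrow> (\<exists>\<nu>::nat. polynomial_fun (\<lambda>y. h y ^ (CHAR('a) ^ \<nu>))))"
proof -
  define F where "F j = Abs_polyfun (mpoly_eval (f $ j))" for j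
  define g where "g = Abs_polyfun (h \<circ> mpoly_map f)"
  have "peval (F j) a = mpoly_eval (f $ j) a" for j a
    by (simp add: F_def Abs_polyfun_inverse polynomial_fun_def exI[of _ "f $ j"])
  then have F: "(\<chi> j. peval (F j) a) = mpoly_map f a" for a by (simp add: mpoly_map_def)
  have "peval g a = h (\<chi> j. peval (F j) a)" for a
    using assms(2) by (simp add: F g_def Abs_polyfun_inverse)
  moreover have "\<exists>a. (\<chi> j. peval (F j) a) = y" for y
    using assms(1) unfolding F by (metis surjD)
  ultimately obtain q where "CHAR('a) = 0 \<longrightarrow> q = 1" "CHAR('a) > 0 \<longrightarrow> (\<exists>\<nu>. q = CHAR('a) ^ \<nu>)"
    "polynomial_fun (\<lambda>y. h y ^ q)"
    using power_polynomial_fun[of F g h] by metis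
  then show ?thesis by (cases "CHAR('a) = 0") auto
qed

end
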